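(* The Surrationals $\mathbb{Q}_\infty$, with the order $\preceq$, addition, negation, multiplication and inversion described in the context and with $0_{\mathbb{Q}}=(0,1)$, $1_{\mathbb{Q}}=(1,1)$, form an ordered Field: $\mathbb{Q}_\infty$ is a proper class, $\preceq$ is a total order on it, $+,\times:\mathbb{Q}_\infty\times\mathbb{Q}_\infty\to\mathbb{Q}_\infty$ and $-,{}^{-1}:\mathbb{Q}_\infty\to\mathbb{Q}_\infty$ are functions, and for all $p,q,r,s\in\mathbb{Q}_\infty$: $(p+q)+r=p+(q+r)$; $p+q=q+p$; $p+0_{\mathbb{Q}}=p$; $p+(-p)=0_{\mathbb{Q}}$; $(pq)r=p(qr)$; $pq=qp$; $p1_{\mathbb{Q}}=p$; $p(q+r)=pq+pr$; if $p\prec q$ and $r\prec s$ then $p+r\prec q+s$; if $0_{\mathbb{Q}}\prec p$ and $0_{\mathbb{Q}}\prec q$ then $0_{\mathbb{Q}}\prec pq$; and every $p\neq 0_{\mathbb{Q}}$ has some $q$ with $pq=1_{\mathbb{Q}}$.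
   Context: $\mathbb{Z}_\infty$ (Surintegers) is the class of pairs $(\alpha,\beta)$ of ordinals whose Cantor normal forms share no exponent, identified with finite formal sums $\sum_\zeta\omega^\zeta c_\zeta$ with $c_\zeta\in\mathbb{Z}$ (positive coefficients from $\beta$, negated coefficients from $\alpha$); $1^{st},2^{nd}$ denote coordinates of a pair. Addition is coefficientwise, $-(\alpha,\beta)=(\beta,\alpha)$, multiplication is $(\sum\omega^\zeta c_\zeta)(\sum\omega^\eta d_\eta)=\sum_\theta\omega^\theta\sum_{\zeta\oplus\eta=\theta}c_\zeta d_\eta$ where $\oplus$ is the natural (Hessenberg) sum of ordinals; $0=(0,0)$, $1=(0,1)$. With $\mathbb{Z}_\infty^+=\{a:1^{st}a\le2^{nd}a\}$, $\mathbb{Z}_\infty^-=\{a:2^{nd}a<1^{st}a\}$, the order is: $a\le b$ iff ($a\in\mathbb{Z}_\infty^-,b\in\mathbb{Z}_\infty^+$) or ($a,b\in\mathbb{Z}_\infty^+$ and [$2^{nd}a<2^{nd}b$ or ($2^{nd}a=2^{nd}b$ and $1^{st}b\le1^{st}a$)]) or ($a,b\in\mathbb{Z}_\infty^-$ and [$1^{st}b<1^{st}a$ or ($1^{st}a=1^{st}b$ and $2^{nd}a\le2^{nd}b$)]). Let $P=\mathbb{Z}_\infty^+\setminus\{0\}$. A pair $(a,b)\in\mathbb{Z}_\infty\times P$ is coprime if every $d\in\mathbb{Z}_\infty$ dividing both $a$ and $b$ (i.e. $a=dc$, $b=dc'$ for some $c,c'\in\mathbb{Z}_\infty$) equals $1$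 or $-1$. $\mathbb{Q}_\infty$ is the class of coprime pairs $(a,b)\in\mathbb{Z}_\infty\times P$. Pairs $(x,y),(x',y')\in\mathbb{Z}_\infty\times P$ are equivalent if $ux=vx'$ and $uy=vy'$ for some nonzero $u,v\in\mathbb{Z}_\infty$; every pair in $\mathbb{Z}_\infty\times P$ is equivalent to exactly one element of $\mathbb{Q}_\infty$, denoted $\overline{(x,y)}$. For $p=(a,b)$, $q=(c,d)$ in $\mathbb{Q}_\infty$: $p+q=\overline{(ad+bc,bd)}$; $-p=(-a,b)$; $pq=\overline{(ac,bd)}$; $p^{-1}=(b,a)$ if $0<a$, $(-b,-a)$ if $a<0$, $(0,1)$ if $a=0$; $p\preceq q$ iff the first coordinate of $q+(-p)$ is $\ge 0$ in $\mathbb{Z}_\infty$. *)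

theory Defs
  imports Main
begin

section \<open>Universes of sets\<close>

text \<open>
  No type of HOL provably contains all ordinals of set theory, so the ambient set theory is
  given as a type class: a type of this class is a universe of sets, the classes are the HOL
  sets over that type, and a class is a set iff it is of the form \<open>elts v\<close>.  The axioms are
  those of ZFC, with replacement stated for arbitrary class functions.  Separation and pairing
  follow from them, and choice is inherited from HOL.
\<close>

class set_universe =
  fixes elts :: "'a \<Rightarrow> 'a set"
  assumes extensionality: "elts x = elts y \<Longrightarrow> x = y"
    and foundation: "wf {(x, y). x \<in> elts y}"
    and union_set: "\<exists>u. elts u = (\<Union>y\<in>elts x. elts y)"
    and power_set: "\<exists>p. elts p = {y. elts y \<subseteq> elts x}"
    and replacement: "\<exists>r. elts r = f ` elts x"
    and infinity: "\<exists>w. (\<exists>e\<in>elts w. elts e = {}) \<and>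
                       (\<forall>x\<in>elts w. \<exists>y\<in>elts w. elts y = insert x (elts x))"

text \<open>
  For classes whose elements are HOL objects rather than members of the universe: such a class
  is a set iff it is in bijection with the elements of some set.  By replacement this agrees
  with being of the form \<open>elts v\<close> for classes of sets.
  A proper class is one that is not \<open>small\<close>.
\<close>

definition small :: "'v::set_universe itself \<Rightarrow> 'a set \<Rightarrow> bool" where
  "small TYPE('v) X \<longleftrightarrow> (\<exists>(f :: 'a \<Rightarrow> 'v) v. inj_on f X \<and> f ` X = elts v)"

lemma small_elts_iff:
  fixes X :: "'v::set_universe set"
  shows "small TYPE('v) X \<longleftrightarrow> (\<exists>v. X = elts v)"
proof
  assume "small TYPE('v) X"
  then obtain f :: "'v \<Rightarrow> 'v" and v where f: "inj_on f X" "f ` X = elts v"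
    unfolding small_def by blast
  obtain r where "elts r = the_inv_into X f ` elts v" using replacement by blast
  also have "\<dots> = X" using f by (metis the_inv_into_onto)
  finally show "\<exists>v. X = elts v" by blast
next
  assume "\<exists>v. X = elts v"
  then show "small TYPE('v) X" unfolding small_def by (metis image_ident inj_on_id2)
qed

section \<open>Von Neumann ordinals\<close>

definition transitive_set :: "'v::set_universe \<Rightarrow> bool" where
  "transitive_set x \<longleftrightarrow> (\<forall>y\<in>elts x. elts y \<subseteq> elts x)"

definition is_ordinal :: "'v::set_universe \<Rightarrow> bool" where
  "is_ordinal x \<longleftrightarrow> transitive_set x \<and> (\<forall>y\<in>elts x. transitive_set y)"

lemma is_ordinal_elts: "is_ordinal x \<Longrightarrow> y \<in> elts x \<Longrightarrow> is_ordinal y"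
  unfolding is_ordinal_def transitive_set_def by blast

lemma is_ordinal_trans: "is_ordinal x \<Longrightarrow> y \<in> elts x \<Longrightarrow> z \<in> elts y \<Longrightarrow> z \<in> elts x"
  unfolding is_ordinal_def transitive_set_def by blast

lemma is_ordinal_trichotomy:
  fixes x y :: "'v::set_universe"
  assumes "is_ordinal x" "is_ordinal y"
  shows "x \<in> elts y \<or> x = y \<or> y \<in> elts x"
  using assms
proof (induction x arbitrary: y rule: wf_induct_rule[OF foundation])
  case (1 x)
  note IHx = 1
  show ?case
    using IHx(3)
  proof (induction y rule: wf_induct_rule[OF foundation])
    case (1 y)
    show ?case
    proof (rule ccontr)
      assume n: "\<not> ?case"
      have "z \<in> elts y" if z: "z \<in> elts x" for z
        using IHx(1)[of z y] z n 1(2) IHx(2) is_ordinal_elts[OF IHx(2) z] is_ordinal_trans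
        by auto
      moreover have "z \<in> elts x" if z: "z \<in> elts y" for z
        using 1(1)[of z] z n 1(2) is_ordinal_elts[OF 1(2) z] is_ordinal_trans by auto
      ultimately have "elts x = elts y" by blast
      with n extensionality show False by blast
    qed
  qed
qed

typedef (overloaded) 'v ordinal = "{x :: 'v::set_universe. is_ordinal x}"
proof -
  obtain e :: 'v where "elts e = {}" using infinity by blast
  then have "is_ordinal e" by (simp add: is_ordinal_def transitive_set_def)
  then show ?thesis by blast
qed

instantiation ordinal :: (set_universe) wellorder
begin

definition less_ordinal :: "'a ordinal \<Rightarrow> 'a ordinal \<Rightarrow> bool" where
  "a < b \<longleftrightarrow> Rep_ordinal a \<in> elts (Rep_ordinal b)"

definition less_eq_ordinal :: "'a ordinal \<Rightarrow> 'a ordinal \<Rightarrow> bool" where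
  "(a :: 'a ordinal) \<le> b \<longleftrightarrow> a < b \<or> a = b"

instance
proof
  fix a b c :: "'a ordinal"
  have tr: "x < y \<Longrightarrow> y < z \<Longrightarrow> x < z" for x y z :: "'a ordinal"
    using is_ordinal_trans Rep_ordinal[of z] by (auto simp: less_ordinal_def)
  have irr: "\<not> x < x" for x :: "'a ordinal"
    using wf_not_refl[OF foundation] by (auto simp: less_ordinal_def)
  show "(a < b) = (a \<le> b \<and> \<not> b \<le> a)"
    unfolding less_eq_ordinal_def by (metis tr irr)
  show "a \<le> a" by (simp add: less_eq_ordinal_def)
  show "a \<le> b \<Longrightarrow> b \<le> c \<Longrightarrow> a \<le> c"
    unfolding less_eq_ordinal_def by (metis tr)
  show "a \<le> b \<Longrightarrow> b \<le> a \<Longrightarrow> a = b"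
    unfolding less_eq_ordinal_def by (metis tr irr)
  show "a \<le> b \<or> b \<le> a"
    using is_ordinal_trichotomy[of "Rep_ordinal a" "Rep_ordinal b"]
      Rep_ordinal[of a] Rep_ordinal[of b]
    by (auto simp: less_eq_ordinal_def less_ordinal_def Rep_ordinal_inject)
next
  fix P :: "'a ordinal \<Rightarrow> bool" and a
  assume step: "\<And>x. (\<And>y. y < x \<Longrightarrow> P y) \<Longrightarrow> P x"
  have "wf (inv_image {(x, y). x \<in> elts y} (Rep_ordinal :: 'a ordinal \<Rightarrow> 'a))"
    by (intro wf_inv_image foundation)
  then show "P a"
    by (induction a rule: wf_induct_rule) (auto intro: step simp: less_ordinal_def in_inv_image)
qed

end

section \<open>Ordinal arithmetic\<close>

definition osup :: "'v::set_universe ordinal set \<Rightarrow> 'v ordinal" where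
  "osup X = (LEAST b. \<forall>x\<in>X. x \<le> b)"

definition osucc :: "'v::set_universe ordinal \<Rightarrow> 'v ordinal" where
  "osucc a = (LEAST b. a < b)"

text \<open>
  Sum, product and power are given by uniform recursions; the clauses at zero, successors
  and limits are derived below.
\<close>

instantiation ordinal :: (set_universe) "{zero, one, plus, times}"
begin

definition zero_ordinal :: "'a ordinal" where
  "(0 :: 'a ordinal) = osup {}"

definition one_ordinal :: "'a ordinal" where
  "(1 :: 'a ordinal) = osucc 0"

function plus_ordinal :: "'a ordinal \<Rightarrow> 'a ordinal \<Rightarrow> 'a ordinal" where
  "plus_ordinal a b = osup (insert a ((\<lambda>d. osucc (plus_ordinal a d)) ` {..<b}))"
  by pat_completeness auto
termination
  by (relation "inv_image {(x, y). x < y} snd") (rule wf_inv_image wf | simp)+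

declare plus_ordinal.simps [simp del]

function times_ordinal :: "'a ordinal \<Rightarrow> 'a ordinal \<Rightarrow> 'a ordinal" where
  "times_ordinal a b = osup ((\<lambda>d. times_ordinal a d + a) ` {..<b})"
  by pat_completeness auto
termination
  by (relation "inv_image {(x, y). x < y} snd") (rule wf_inv_image wf | simp)+

declare times_ordinal.simps [simp del]

instance ..

end

primrec ord_of_nat :: "nat \<Rightarrow> 'v::set_universe ordinal" where
  "ord_of_nat 0 = 0"
| "ord_of_nat (Suc n) = osucc (ord_of_nat n)"

definition omega :: "'v::set_universe ordinal" where
  "omega = osup (range ord_of_nat)"

function omega_pow :: "'v::set_universe ordinal \<Rightarrow> 'v ordinal" where
  "omega_pow b = osup (insert 1 ((\<lambda>d. omega_pow d * omega) ` {..<b}))"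
  by pat_completeness auto
termination
  by (relation "{(x, y). x < y}") (rule wf | simp)+

declare omega_pow.simps [simp del]

subsection \<open>The recursion clauses\<close>

lemma empty_set: "\<exists>e :: 'v::set_universe. elts e = {}"
  using infinity by blast

lemma separation:
  fixes x :: "'v::set_universe"
  assumes "A \<subseteq> elts x"
  shows "\<exists>r. elts r = A"
proof (cases "A = {}")
  case True
  then show ?thesis using empty_set by blast
next
  case False
  then obtain a where a: "a \<in> A" by blast
  obtain r where "elts r = (\<lambda>y. if y \<in> A then y else a) ` elts x"
    using replacement by blast
  also have "\<dots> = A" using assms a by auto
  finally show ?thesis by blast
qed

lemma ordinal_above:
  fixes v :: "'v::set_universe"
  assumes "\<forall>x\<in>elts v. is_ordinal x"
  shows "\<exists>u. is_ordinal u \<and> (\<forall>x\<in>elts v. x \<in> elts u)"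
proof -
  have sub: "y \<in> elts x \<Longrightarrow> elts y \<subseteq> elts x \<and> is_ordinal y" if "is_ordinal x" for x y :: 'v
    using that is_ordinal_elts is_ordinal_trans by blast
  obtain u where u: "elts u = (\<Union>y\<in>elts v. elts y)" using union_set by blast
  have o: "is_ordinal y" if "y \<in> elts u" for y
    using that u assms sub by auto
  have "transitive_set u" unfolding transitive_set_def
    using u assms sub by (smt (verit) UN_iff subset_iff)
  then have ou: "is_ordinal u" using o by (auto simp: is_ordinal_def)
  obtain p where p: "elts p = {y. elts y \<subseteq> elts u}" using power_set by blast
  have "{y. is_ordinal y \<and> elts y \<subseteq> elts u} \<subseteq> elts p" using p by auto
  then obtain s where s: "elts s = {y. is_ordinal y \<and> elts y \<subseteq> elts u}"
    using separation by blast
  have "transitive_set s" unfolding transitive_set_def s using sub by blast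
  moreover have "transitive_set y" if "y \<in> elts s" for y
    using that s by (simp add: is_ordinal_def)
  ultimately have "is_ordinal s" by (simp add: is_ordinal_def)
  moreover have "\<forall>x\<in>elts v. x \<in> elts s" using s u assms by auto
  ultimately show ?thesis by blast
qed

lemma lessThan_eq: "{..<b} = Abs_ordinal ` elts (Rep_ordinal b)" for b :: "'v::set_universe ordinal"
proof -
  have "Rep_ordinal (Abs_ordinal x) = x" if "x \<in> elts (Rep_ordinal b)" for x
    using that Rep_ordinal[of b] is_ordinal_elts Abs_ordinal_inverse by auto
  then show ?thesis
    by (force simp: less_ordinal_def image_iff Rep_ordinal_inverse)
qed

lemma image_bounded:
  fixes f :: "'v ordinal \<Rightarrow> 'v::set_universe ordinal"
  shows "\<exists>u. \<forall>d<b. f d < u"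
proof -
  obtain v where v: "elts v = (\<lambda>x. Rep_ordinal (f (Abs_ordinal x))) ` elts (Rep_ordinal b)"
    using replacement by blast
  then have "\<forall>x\<in>elts v. is_ordinal x" using Rep_ordinal by auto
  then obtain u where u: "is_ordinal u" "\<forall>x\<in>elts v. x \<in> elts u" using ordinal_above by blast
  have "f d < Abs_ordinal u" if "d < b" for d
  proof -
    have "d \<in> Abs_ordinal ` elts (Rep_ordinal b)" using that lessThan_eq by blast
    then have "Rep_ordinal (f d) \<in> elts v" using v by auto
    with u show ?thesis by (simp add: less_ordinal_def Abs_ordinal_inverse)
  qed
  then show ?thesis by blast
qed

lemma ordinal_no_top: "\<exists>b. a < b" for a :: "'v::set_universe ordinal"
proof -
  obtain p where p: "elts p = {y. elts y \<subseteq> elts (Rep_ordinal a)}" using power_set by blast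
  then obtain s where s: "elts s = {Rep_ordinal a}" using separation[of "{Rep_ordinal a}" p] by auto
  with Rep_ordinal[of a] have "\<forall>x\<in>elts s. is_ordinal x" by auto
  then obtain w where "is_ordinal w" "Rep_ordinal a \<in> elts w" using ordinal_above s by blast
  then have "a < Abs_ordinal w" by (simp add: less_ordinal_def Abs_ordinal_inverse)
  then show ?thesis by blast
qed

lemma less_osucc: "a < osucc a" for a :: "'v::set_universe ordinal"
  unfolding osucc_def using ordinal_no_top by (rule LeastI_ex)

lemma osucc_le_iff: "osucc a \<le> b \<longleftrightarrow> a < b" for a b :: "'v::set_universe ordinal"
  using less_osucc[of a] unfolding osucc_def by (metis Least_le less_le_trans)

lemma less_osucc_iff: "b < osucc a \<longleftrightarrow> b \<le> a" for a b :: "'v::set_universe ordinal"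
  using osucc_le_iff[of a b] by (meson not_le)

lemma osup_le_iff:
  fixes X :: "'v::set_universe ordinal set"
  assumes "\<exists>u. \<forall>x\<in>X. x \<le> u"
  shows "osup X \<le> b \<longleftrightarrow> (\<forall>x\<in>X. x \<le> b)"
proof
  assume "osup X \<le> b"
  then show "\<forall>x\<in>X. x \<le> b"
    using LeastI_ex[OF assms] unfolding osup_def by (meson order_trans)
next
  assume "\<forall>x\<in>X. x \<le> b"
  then show "osup X \<le> b" unfolding osup_def by (rule Least_le)
qed

lemma osup_image_le_iff:
  fixes f :: "'v::set_universe ordinal \<Rightarrow> 'v ordinal"
  shows "osup (f ` {..<b}) \<le> c \<longleftrightarrow> (\<forall>d<b. f d \<le> c)"
proof -
  have "\<exists>u. \<forall>x\<in>f ` {..<b}. x \<le> u" using image_bounded[of b f] by (auto intro: less_imp_le)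
  from osup_le_iff[OF this] show ?thesis by auto
qed

lemma osup_insert_image_le_iff:
  fixes f :: "'v::set_universe ordinal \<Rightarrow> 'v ordinal"
  shows "osup (insert a (f ` {..<b})) \<le> c \<longleftrightarrow> a \<le> c \<and> (\<forall>d<b. f d \<le> c)"
proof -
  obtain u where u: "\<forall>d<b. f d < u" using image_bounded[of b f] by blast
  have "\<exists>u. \<forall>x\<in>insert a (f ` {..<b}). x \<le> u"
    by (rule exI[of _ "max a u"]) (use u in \<open>auto simp: le_max_iff_disj\<close>)
  from osup_le_iff[OF this] show ?thesis by auto
qed

lemma ordinal_eqI:
  fixes a b :: "'v::set_universe ordinal"
  shows "(\<And>c. a \<le> c \<longleftrightarrow> b \<le> c) \<Longrightarrow> a = b"
  by (meson order_antisym order_refl)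

lemma zero_le_ordinal: "0 \<le> (a :: 'v::set_universe ordinal)"
  by (simp add: zero_ordinal_def osup_le_iff)

definition is_limit :: "'v::set_universe ordinal \<Rightarrow> bool" where
  "is_limit l \<longleftrightarrow> l \<noteq> 0 \<and> (\<forall>b<l. osucc b < l)"

lemma ordinal_cases: "b = 0 \<or> (\<exists>c. b = osucc c) \<or> is_limit b" for b :: "'v::set_universe ordinal"
  unfolding is_limit_def using osucc_le_iff by (metis le_less)

lemma plus_le_iff: "a + b \<le> c \<longleftrightarrow> a \<le> c \<and> (\<forall>d<b. a + d < c)" for a b c :: "'v::set_universe ordinal"
  by (subst plus_ordinal.simps) (simp only: osup_insert_image_le_iff osucc_le_iff)

lemma times_le_iff: "a * b \<le> c \<longleftrightarrow> (\<forall>d<b. a * d + a \<le> c)" for a b c :: "'v::set_universe ordinal"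
  by (subst times_ordinal.simps) (simp only: osup_image_le_iff)

lemma omega_pow_le_iff: "omega_pow b \<le> c \<longleftrightarrow> 1 \<le> c \<and> (\<forall>d<b. omega_pow d * omega \<le> c)"
  by (subst omega_pow.simps) (simp only: osup_insert_image_le_iff)

lemma plus_strict_mono: "d < b \<Longrightarrow> a + d < a + b" for a b :: "'v::set_universe ordinal"
  using plus_le_iff[of a b "a + b"] by auto

lemma plus_mono_left: "a \<le> a' \<Longrightarrow> a + b \<le> a' + b" for a b :: "'v::set_universe ordinal"
proof (induction b rule: less_induct)
  case (less b)
  have "a' \<le> a' + b" using plus_le_iff[of a' b "a' + b"] by auto
  with less show ?case
    unfolding plus_le_iff[of a b] by (meson le_less_trans order_trans plus_strict_mono)
qed

theorem plus_zero: "a + 0 = (a :: 'v::set_universe ordinal)"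
  by (rule ordinal_eqI) (auto simp: plus_le_iff zero_le_ordinal leD)

theorem plus_osucc: "a + osucc b = osucc (a + b)" for a b :: "'v::set_universe ordinal"
proof (rule ordinal_eqI)
  fix c
  have "a \<le> a + b" using plus_le_iff[of a b "a + b"] by auto
  moreover have "d \<le> b \<Longrightarrow> a + d \<le> a + b" for d
    using plus_strict_mono[of d b a] by (auto simp: le_less)
  ultimately have "a + b < c \<longleftrightarrow> a \<le> c \<and> (\<forall>d\<le>b. a + d < c)"
    by (meson le_less_trans less_imp_le order_refl)
  then show "a + osucc b \<le> c \<longleftrightarrow> osucc (a + b) \<le> c"
    unfolding plus_le_iff[of a "osucc b"] less_osucc_iff osucc_le_iff by simp
qed

theorem plus_limit:
  fixes a l :: "'v::set_universe ordinal"
  assumes "is_limit l"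
  shows "a + l = osup ((\<lambda>d. a + d) ` {..<l})"
proof (rule ordinal_eqI)
  fix c
  have "0 < l" using assms zero_le_ordinal[of l] by (auto simp: is_limit_def le_less)
  have "(\<forall>d<l. a + d < c) \<longleftrightarrow> (\<forall>d<l. a + d \<le> c)"
    using assms plus_strict_mono[OF less_osucc] unfolding is_limit_def
    by (meson less_imp_le less_le_trans)
  moreover have "a \<le> c" if "\<forall>d<l. a + d \<le> c" using that \<open>0 < l\<close> plus_zero by metis
  ultimately show "a + l \<le> c \<longleftrightarrow> osup ((\<lambda>d. a + d) ` {..<l}) \<le> c"
    unfolding plus_le_iff[of a l] osup_image_le_iff by blast
qed

lemma times_mono: "d \<le> b \<Longrightarrow> a * d \<le> a * b" for a b :: "'v::set_universe ordinal"
  using times_le_iff[of a b "a * b"] times_le_iff[of a d "a * b"] by auto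

theorem times_zero: "a * 0 = (0 :: 'v::set_universe ordinal)"
  by (rule ordinal_eqI) (auto simp: times_le_iff zero_le_ordinal leD)

theorem times_osucc: "a * osucc b = a * b + a" for a b :: "'v::set_universe ordinal"
proof (rule ordinal_eqI)
  show "a * osucc b \<le> c \<longleftrightarrow> a * b + a \<le> c" for c
    unfolding times_le_iff[of a "osucc b"] less_osucc_iff
    by (meson order_refl order_trans plus_mono_left times_mono)
qed

theorem times_limit:
  fixes a l :: "'v::set_universe ordinal"
  assumes "is_limit l"
  shows "a * l = osup ((\<lambda>d. a * d) ` {..<l})"
proof (rule ordinal_eqI)
  fix c
  have "a * d \<le> a * osucc d" for d by (simp add: times_mono less_osucc less_imp_le)
  then have "(\<forall>d<l. a * osucc d \<le> c) \<longleftrightarrow> (\<forall>d<l. a * d \<le> c)"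
    using assms unfolding is_limit_def by (meson order_trans)
  then show "a * l \<le> c \<longleftrightarrow> osup ((\<lambda>d. a * d) ` {..<l}) \<le> c"
    unfolding times_le_iff[of a l] osup_image_le_iff times_osucc .
qed

lemma omega_pow_mono: "d \<le> b \<Longrightarrow> omega_pow d \<le> omega_pow b"
  using omega_pow_le_iff[of b "omega_pow b"] omega_pow_le_iff[of d "omega_pow b"] by auto

lemma times_mono_left: "a \<le> a' \<Longrightarrow> a * b \<le> a' * b" for a b :: "'v::set_universe ordinal"
proof (induction b rule: less_induct)
  case (less b)
  have "a * d + a \<le> a' * b" if "d < b" for d
  proof -
    have "a * d + a \<le> a' * d + a" using less that by (simp add: plus_mono_left)
    also have "\<dots> \<le> a' * d + a'"
      using less.prems plus_strict_mono[of a a' "a' * d"] by (auto simp: le_less)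
    also have "\<dots> \<le> a' * b" using times_le_iff[of a' b "a' * b"] that by auto
    finally show ?thesis .
  qed
  then show ?case by (simp add: times_le_iff[of a b])
qed

lemma omega_bounded: "\<exists>u. \<forall>x\<in>range (ord_of_nat :: nat \<Rightarrow> 'v::set_universe ordinal). x \<le> u"
proof -
  obtain w e :: 'v where w: "e \<in> elts w" "elts e = {}"
    "\<And>x. x \<in> elts w \<Longrightarrow> \<exists>y\<in>elts w. elts y = insert x (elts x)"
    using infinity by metis
  obtain s where s: "\<And>x. x \<in> elts w \<Longrightarrow> s x \<in> elts w \<and> elts (s x) = insert x (elts x)"
    using w(3) by metis
  have "Rep_ordinal (ord_of_nat n) \<in> elts w" for n
  proof (induction n)
    case 0
    have "is_ordinal e" using w(2) by (simp add: is_ordinal_def transitive_set_def)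
    then have "Rep_ordinal (Abs_ordinal e) = e" by (simp add: Abs_ordinal_inverse)
    then have "\<not> x < Abs_ordinal e" for x using w(2) by (simp add: less_ordinal_def)
    then have "Abs_ordinal e = 0" by (metis le_less not_le zero_le_ordinal)
    then show ?case using \<open>Rep_ordinal (Abs_ordinal e) = e\<close> w(1) by simp
  next
    case (Suc n)
    let ?a = "ord_of_nat n :: 'v ordinal"
    let ?y = "s (Rep_ordinal ?a)"
    have y: "?y \<in> elts w" "elts ?y = insert (Rep_ordinal ?a) (elts (Rep_ordinal ?a))"
      using s[OF Suc] by auto
    have "is_ordinal (Rep_ordinal ?a)" using Rep_ordinal by blast
    then have "is_ordinal ?y" unfolding is_ordinal_def transitive_set_def y(2) by auto
    then have r: "Rep_ordinal (Abs_ordinal ?y) = ?y" by (simp add: Abs_ordinal_inverse)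
    have "x < Abs_ordinal ?y \<longleftrightarrow> x \<le> ?a" for x
      by (auto simp: less_ordinal_def r y(2) less_eq_ordinal_def Rep_ordinal_inject)
    then have "Abs_ordinal ?y = osucc ?a" by (metis less_osucc_iff not_less_iff_gr_or_eq)
    then show ?case using r y(1) by simp
  qed
  moreover have "range (ord_of_nat :: nat \<Rightarrow> 'v ordinal) = Abs_ordinal ` range (\<lambda>n. Rep_ordinal (ord_of_nat n))"
    by (simp add: image_image Rep_ordinal_inverse)
  ultimately have *: "range (\<lambda>n. Rep_ordinal (ord_of_nat n :: 'v ordinal)) \<subseteq> elts w" by blast
  then obtain v where v: "elts v = range (\<lambda>n. Rep_ordinal (ord_of_nat n :: 'v ordinal))"
    using separation by blast
  then have "\<forall>x\<in>elts v. is_ordinal x" using Rep_ordinal by auto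
  then obtain u where "is_ordinal u" "\<forall>x\<in>elts v. x \<in> elts u" using ordinal_above by blast
  then have "ord_of_nat n < Abs_ordinal u" for n
    using v by (simp add: less_ordinal_def Abs_ordinal_inverse)
  then show ?thesis by (auto intro: less_imp_le)
qed

theorem less_omega_iff: "a < omega \<longleftrightarrow> (\<exists>n. a = ord_of_nat n)"
proof
  assume "a < omega"
  then obtain n where n: "a < ord_of_nat n"
    using osup_le_iff[OF omega_bounded, of a] unfolding omega_def by (metis not_le rangeE)
  then show "\<exists>n. a = ord_of_nat n"
  proof (induction n)
    case 0
    then show ?case using zero_le_ordinal[of a] by (simp add: leD)
  next
    case (Suc n)
    then show ?case by (auto simp: less_osucc_iff le_less)
  qed
next
  assume "\<exists>n. a = ord_of_nat n"
  then obtain n where "a = ord_of_nat n" by blast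
  then have "a < ord_of_nat (Suc n)" by (simp add: less_osucc)
  also have "\<dots> \<le> omega"
    using osup_le_iff[OF omega_bounded, of omega] unfolding omega_def by blast
  finally show "a < omega" .
qed

lemma times_one: "a * 1 = (a :: 'v::set_universe ordinal)"
proof -
  have "0 + a = a" for a :: "'v ordinal"
  proof (induction a rule: less_induct)
    case (less a)
    then show ?case by (intro ordinal_eqI) (auto simp: plus_le_iff zero_le_ordinal intro: leI)
  qed
  then show ?thesis by (simp add: one_ordinal_def times_osucc times_zero)
qed

lemma le_times_omega: "a \<le> a * omega" for a :: "'v::set_universe ordinal"
proof -
  have "1 < (omega :: 'v ordinal)"
    using less_omega_iff[of "1 :: 'v ordinal"] ord_of_nat.simps by (metis one_ordinal_def)
  then have "a * 1 \<le> a * omega" by (intro times_mono less_imp_le)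
  then show ?thesis by (simp add: times_one)
qed

theorem omega_pow_zero: "omega_pow 0 = 1"
  by (rule ordinal_eqI) (auto simp: omega_pow_le_iff zero_le_ordinal leD)

theorem omega_pow_osucc: "omega_pow (osucc b) = omega_pow b * omega"
proof (rule ordinal_eqI)
  have "1 \<le> omega_pow b" using omega_pow_le_iff[of b "omega_pow b"] by auto
  then have "1 \<le> omega_pow b * omega" using le_times_omega by (meson order_trans)
  then show "omega_pow (osucc b) \<le> c \<longleftrightarrow> omega_pow b * omega \<le> c" for c
    unfolding omega_pow_le_iff[of "osucc b"] less_osucc_iff
    by (meson order_refl order_trans omega_pow_mono times_mono_left)
qed

theorem omega_pow_limit:
  assumes "is_limit l"
  shows "omega_pow l = osup (omega_pow ` {..<l})"
proof (rule ordinal_eqI)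
  fix c
  have "0 < l" using assms zero_le_ordinal[of l] by (auto simp: is_limit_def le_less)
  have "(\<forall>d<l. omega_pow (osucc d) \<le> c) \<longleftrightarrow> (\<forall>d<l. omega_pow d \<le> c)"
    using assms omega_pow_mono[OF less_imp_le[OF less_osucc]] unfolding is_limit_def
    by (meson order_trans)
  moreover have "1 \<le> c" if "\<forall>d<l. omega_pow d \<le> c" using that \<open>0 < l\<close> omega_pow_zero by metis
  ultimately show "omega_pow l \<le> c \<longleftrightarrow> osup (omega_pow ` {..<l}) \<le> c"
    unfolding omega_pow_le_iff[of l] osup_image_le_iff omega_pow_osucc by blast
qed

section \<open>Cantor normal form and natural sum\<close>

text \<open>
  The list \<open>[(z1, c1), \<dots>, (zk, ck)]\<close> stands for
  \<open>omega^z1 * c1 + \<dots> + omega^zk * ck\<close>, with \<open>z1 > \<dots> > zk\<close> and \<open>ci > 0\<close>.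
\<close>

type_synonym 'v cnf_list = "('v ordinal \<times> nat) list"

definition is_cnf :: "'v::set_universe cnf_list \<Rightarrow> bool" where
  "is_cnf ts \<longleftrightarrow> sorted_wrt (>) (map fst ts) \<and> (\<forall>(z, c)\<in>set ts. c > 0)"

definition cnf_value :: "'v::set_universe cnf_list \<Rightarrow> 'v ordinal" where
  "cnf_value ts = foldr (\<lambda>(z, c) a. omega_pow z * ord_of_nat c + a) ts 0"

definition cnf :: "'v::set_universe ordinal \<Rightarrow> 'v cnf_list" where
  "cnf a = (THE ts. is_cnf ts \<and> cnf_value ts = a)"

definition cnf_exponents :: "'v::set_universe ordinal \<Rightarrow> 'v ordinal set" where
  "cnf_exponents a = fst ` set (cnf a)"

definition cnf_coeff :: "'v::set_universe ordinal \<Rightarrow> 'v ordinal \<Rightarrow> nat" where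
  "cnf_coeff a z = (case map_of (cnf a) z of None \<Rightarrow> 0 | Some c \<Rightarrow> c)"

definition natural_sum :: "'v::set_universe ordinal \<Rightarrow> 'v ordinal \<Rightarrow> 'v ordinal" where
  "natural_sum a b = (THE g. \<forall>z. cnf_coeff g z = cnf_coeff a z + cnf_coeff b z)"

section \<open>Surintegers\<close>

type_synonym 'v surint = "'v ordinal \<times> 'v ordinal"

definition surints :: "'v::set_universe surint set" where
  "surints = {(a, b). cnf_exponents a \<inter> cnf_exponents b = {}}"

text \<open>
  \<open>coeff\<close> and \<open>surint_of\<close> identify a surinteger with its formal sum, given as the function
  mapping each exponent to its coefficient.
\<close>

definition coeff :: "'v::set_universe surint \<Rightarrow> 'v ordinal \<Rightarrow> int" where
  "coeff a z = int (cnf_coeff (snd a) z) - int (cnf_coeff (fst a) z)"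

definition surint_of :: "('v::set_universe ordinal \<Rightarrow> int) \<Rightarrow> 'v surint" where
  "surint_of f = (THE a. a \<in> surints \<and> coeff a = f)"

definition zzero :: "'v::set_universe surint" where
  "zzero = (0, 0)"

definition zone :: "'v::set_universe surint" where
  "zone = (0, 1)"

definition zadd :: "'v::set_universe surint \<Rightarrow> 'v surint \<Rightarrow> 'v surint" (infixl \<open>+\<^sub>Z\<close> 65) where
  "a +\<^sub>Z b = surint_of (\<lambda>z. coeff a z + coeff b z)"

definition zneg :: "'v::set_universe surint \<Rightarrow> 'v surint" (\<open>-\<^sub>Z _\<close> [81] 80) where
  "-\<^sub>Z a = (snd a, fst a)"

definition zmul :: "'v::set_universe surint \<Rightarrow> 'v surint \<Rightarrow> 'v surint" (infixl \<open>*\<^sub>Z\<close> 70) where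
  "a *\<^sub>Z b = surint_of (\<lambda>t. \<Sum>(z, e) | coeff a z \<noteq> 0 \<and> coeff b e \<noteq> 0 \<and> natural_sum z e = t.
     coeff a z * coeff b e)"

definition surints_pos :: "'v::set_universe surint set" where
  "surints_pos = {a \<in> surints. fst a \<le> snd a}"

definition surints_neg :: "'v::set_universe surint set" where
  "surints_neg = {a \<in> surints. snd a < fst a}"

definition zle :: "'v::set_universe surint \<Rightarrow> 'v surint \<Rightarrow> bool" (infix \<open>\<le>\<^sub>Z\<close> 50) where
  "a \<le>\<^sub>Z b \<longleftrightarrow>
     a \<in> surints_neg \<and> b \<in> surints_pos \<or>
     a \<in> surints_pos \<and> b \<in> surints_pos \<and>
       (snd a < snd b \<or> snd a = snd b \<and> fst b \<le> fst a) \<or>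
     a \<in> surints_neg \<and> b \<in> surints_neg \<and>
       (fst b < fst a \<or> fst a = fst b \<and> snd a \<le> snd b)"

definition zless :: "'v::set_universe surint \<Rightarrow> 'v surint \<Rightarrow> bool" (infix \<open><\<^sub>Z\<close> 50) where
  "a <\<^sub>Z b \<longleftrightarrow> a \<le>\<^sub>Z b \<and> a \<noteq> b"

definition zdvd :: "'v::set_universe surint \<Rightarrow> 'v surint \<Rightarrow> bool" (infix \<open>dvd\<^sub>Z\<close> 50) where
  "d dvd\<^sub>Z a \<longleftrightarrow> (\<exists>c\<in>surints. a = d *\<^sub>Z c)"

section \<open>Surrationals\<close>

definition denoms :: "'v::set_universe surint set" where
  "denoms = surints_pos - {zzero}"

definition zcoprime :: "'v::set_universe surint \<Rightarrow> 'v surint \<Rightarrow> bool" where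
  "zcoprime a b \<longleftrightarrow>
     (\<forall>d\<in>surints. d dvd\<^sub>Z a \<and> d dvd\<^sub>Z b \<longrightarrow> d = zone \<or> d = -\<^sub>Z zone)"

type_synonym 'v surrat = "'v surint \<times> 'v surint"

definition surrats :: "'v::set_universe surrat set" where
  "surrats = {(a, b). a \<in> surints \<and> b \<in> denoms \<and> zcoprime a b}"

definition fraction_equiv :: "'v::set_universe surrat \<Rightarrow> 'v surrat \<Rightarrow> bool" where
  "fraction_equiv p q \<longleftrightarrow>
     (\<exists>u\<in>surints. \<exists>v\<in>surints. u \<noteq> zzero \<and> v \<noteq> zzero \<and>
        u *\<^sub>Z fst p = v *\<^sub>Z fst q \<and> u *\<^sub>Z snd p = v *\<^sub>Z snd q)"

definition reduce :: "'v::set_universe surrat \<Rightarrow> 'v surrat" where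
  "reduce p = (THE q. q \<in> surrats \<and> fraction_equiv p q)"

definition qzero :: "'v::set_universe surrat" where
  "qzero = (zzero, zone)"

definition qone :: "'v::set_universe surrat" where
  "qone = (zone, zone)"

definition qadd :: "'v::set_universe surrat \<Rightarrow> 'v surrat \<Rightarrow> 'v surrat" (infixl \<open>+\<^sub>Q\<close> 65) where
  "p +\<^sub>Q q = reduce (fst p *\<^sub>Z snd q +\<^sub>Z snd p *\<^sub>Z fst q, snd p *\<^sub>Z snd q)"

definition qneg :: "'v::set_universe surrat \<Rightarrow> 'v surrat" (\<open>-\<^sub>Q _\<close> [81] 80) where
  "-\<^sub>Q p = (-\<^sub>Z fst p, snd p)"

definition qmul :: "'v::set_universe surrat \<Rightarrow> 'v surrat \<Rightarrow> 'v surrat" (infixl \<open>*\<^sub>Q\<close> 70) where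
  "p *\<^sub>Q q = reduce (fst p *\<^sub>Z fst q, snd p *\<^sub>Z snd q)"

definition qinv :: "'v::set_universe surrat \<Rightarrow> 'v surrat" where
  "qinv p =
     (if zzero <\<^sub>Z fst p then (snd p, fst p)
      else if fst p <\<^sub>Z zzero then (-\<^sub>Z snd p, -\<^sub>Z fst p)
      else (zzero, zone))"

definition qle :: "'v::set_universe surrat \<Rightarrow> 'v surrat \<Rightarrow> bool" (infix \<open>\<preceq>\<^sub>Q\<close> 50) where
  "p \<preceq>\<^sub>Q q \<longleftrightarrow> zzero \<le>\<^sub>Z fst (q +\<^sub>Q -\<^sub>Q p)"

definition qless :: "'v::set_universe surrat \<Rightarrow> 'v surrat \<Rightarrow> bool" (infix \<open>\<prec>\<^sub>Q\<close> 50) where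
  "p \<prec>\<^sub>Q q \<longleftrightarrow> p \<preceq>\<^sub>Q q \<and> p \<noteq> q"

end

theory Submission
  imports Defs "HOL-Library.Poly_Mapping" "HOL-Library.Dual_Ordered_Lattice"
    "HOL-Computational_Algebra.Polynomial" "HOL-Computational_Algebra.Fraction_Field"
begin

text \<open>
  Reading exponents as monomials via the Cantor normal form, natural sum becomes multiplication of
  monomials, so the surintegers are the polynomial ring over the integers with one variable per
  ordinal.  Any finite set of its elements lies in a polynomial ring in finitely many variables,
  so Gauss' lemma makes irreducible elements prime and reduced fractions unique.  Hence the
  surrationals are the fraction field of that ring, and their order comes from the sign
  of the leading coefficient, since ordinals are compared at the greatest exponent at which
  their Cantor normal forms differ.
\<close>

section \<open>Gauss' lemma for subrings\<close>

text \<open>A HOL type cannot depend on a finite set of variables, so the induction over the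
  variables takes place among subrings of one fixed ring, with \<open>dvd\<close> and
  \<open>irreducible\<close> always taken in the whole ring. This does no harm because a divisor of
  a nonzero polynomial involves only variables of that polynomial. With infinitely many variables no
  noetherian argument is at hand; factorization terminates because every finite set of variables
  carries a height in the natural numbers, built as degree plus height of the leading coefficient
  and starting with the absolute value on the integers. Gauss' lemma is applied without contents and
  without a fraction field of the coefficients: the constant that pseudo-division introduces is
  removed again, one irreducible factor at a time. The units are 1 and -1, which is exactly the
  ambiguity that a positive denominator removes.\<close>

definition irreducibles_prime_in :: "'a::idom set \<Rightarrow> bool" where
  "irreducibles_prime_in R \<longleftrightarrow>
     (\<forall>p\<in>R. irreducible p \<longrightarrow> (\<forall>a\<in>R. \<forall>b\<in>R. p dvd a * b \<longrightarrow> p dvd a \<or> p dvd b))"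

text \<open>A proper divisor has strictly smaller height, so descent along proper divisors of
  nonzero elements of \<open>R\<close> terminates. A number is preferred to a chain condition
  because it can simply be added to the degree when a variable is adjoined.\<close>

definition divisor_height :: "'a::idom set \<Rightarrow> ('a \<Rightarrow> nat) \<Rightarrow> bool" where
  "divisor_height R N \<longleftrightarrow>
     (\<forall>a b. b \<in> R \<longrightarrow> b \<noteq> 0 \<longrightarrow> a dvd b \<longrightarrow> N a \<le> N b \<and> (N a = N b \<longrightarrow> b dvd a))"

section \<open>Subrings and polynomials in one transcendental element\<close>

locale idom_subring =
  fixes R :: "'a::idom set"
  assumes one_closed: "1 \<in> R"
    and diff_closed: "a \<in> R \<Longrightarrow> b \<in> R \<Longrightarrow> a - b \<in> R"
    and mult_closed: "a \<in> R \<Longrightarrow> b \<in> R \<Longrightarrow> a * b \<in> R"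
begin

lemma zero_closed: "0 \<in> R"
  using diff_closed[OF one_closed one_closed] by simp

lemma add_closed: "a \<in> R \<Longrightarrow> b \<in> R \<Longrightarrow> a + b \<in> R"
  using diff_closed[of a "0 - b"] diff_closed[OF zero_closed, of b] by simp

lemma sum_closed: "(\<And>i. i \<in> I \<Longrightarrow> f i \<in> R) \<Longrightarrow> sum f I \<in> R"
  by (induction I rule: infinite_finite_induct) (auto simp: zero_closed add_closed)

end

text \<open>\<open>x\<close> is transcendental over \<open>R\<close>, so \<open>ext\<close> is the
  polynomial ring R[x] realized inside the ambient ring, and \<open>rep\<close> recovers the unique
  polynomial behind an element.\<close>

locale free_extension = idom_subring R for R :: "'a::idom set" +
  fixes x :: 'a
  assumes free: "(\<And>k. coeff p k \<in> R) \<Longrightarrow> poly p x = 0 \<Longrightarrow> p = 0"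
begin

definition polys :: "'a poly set" where
  "polys = {p. \<forall>k. coeff p k \<in> R}"

definition ext :: "'a set" where
  "ext = (\<lambda>p. poly p x) ` polys"

definition rep :: "'a \<Rightarrow> 'a poly" where
  "rep f = (THE p. p \<in> polys \<and> poly p x = f)"

abbreviation deg :: "'a \<Rightarrow> nat" where "deg f \<equiv> degree (rep f)"

lemma polys_diff: "p \<in> polys \<Longrightarrow> q \<in> polys \<Longrightarrow> p - q \<in> polys"
  by (simp add: polys_def diff_closed)

lemma polys_mult: "p \<in> polys \<Longrightarrow> q \<in> polys \<Longrightarrow> p * q \<in> polys"
  by (auto simp: polys_def coeff_mult intro!: sum_closed mult_closed)

lemma polys_monom: "c \<in> R \<Longrightarrow> monom c n \<in> polys"
  by (simp add: polys_def zero_closed)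

lemma poly_inj:
  assumes "p \<in> polys" "q \<in> polys" "poly p x = poly q x"
  shows "p = q"
  using free[of "p - q"] polys_diff[OF assms(1,2)] assms(3) by (simp add: polys_def)

lemma rep_poly: "p \<in> polys \<Longrightarrow> rep (poly p x) = p"
  unfolding rep_def by (rule the_equality) (auto intro: poly_inj)

lemma rep_in: "f \<in> ext \<Longrightarrow> rep f \<in> polys"
  by (auto simp: ext_def rep_poly)

lemma poly_rep: "f \<in> ext \<Longrightarrow> poly (rep f) x = f"
  by (auto simp: ext_def rep_poly)

lemma ext_rep_eqI: "p \<in> polys \<Longrightarrow> poly p x = f \<Longrightarrow> f \<in> ext \<and> rep f = p"
  by (auto simp: ext_def rep_poly)

lemma ext_diff:
  assumes "f \<in> ext" "g \<in> ext" shows "f - g \<in> ext \<and> rep (f - g) = rep f - rep g"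
  using assms by (intro ext_rep_eqI) (auto simp: polys_diff rep_in poly_rep)

lemma ext_mult:
  assumes "f \<in> ext" "g \<in> ext" shows "f * g \<in> ext \<and> rep (f * g) = rep f * rep g"
  using assms by (intro ext_rep_eqI) (auto simp: polys_mult rep_in poly_rep)

lemma ext_const: "c \<in> R \<Longrightarrow> c \<in> ext \<and> rep c = [:c:]"
  by (rule ext_rep_eqI) (use polys_monom[of c 0] in \<open>auto simp: monom_0\<close>)

lemma rep_eq_0: "f \<in> ext \<Longrightarrow> rep f = 0 \<longleftrightarrow> f = 0"
  using poly_rep[of f] ext_const[OF zero_closed] by auto

lemma lead_in: "f \<in> ext \<Longrightarrow> lead_coeff (rep f) \<in> R"
  using rep_in by (auto simp: polys_def)

lemma deg_0_in: "f \<in> ext \<Longrightarrow> deg f = 0 \<Longrightarrow> f \<in> R"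
  using poly_rep[of f] lead_in[of f] by (auto elim: degree_eq_zeroE)

lemma deg_mult: "f \<in> ext \<Longrightarrow> g \<in> ext \<Longrightarrow> f \<noteq> 0 \<Longrightarrow> g \<noteq> 0 \<Longrightarrow> deg (f * g) = deg f + deg g"
  by (simp add: ext_mult degree_mult_eq rep_eq_0)

text \<open>Degrees add in a nonzero product, so a product of degree 0 has only factors of degree
  0.\<close>

lemma base_factor_closed:
  assumes "f \<in> ext" "g \<in> ext" "f * g \<in> R" "f * g \<noteq> 0"
  shows "f \<in> R"
proof -
  have "deg f + deg g = 0" using deg_mult[OF assms(1,2)] ext_const[OF assms(3)] assms(4) by auto
  then show ?thesis using deg_0_in assms(1) by simp
qed

lemma ext_pow: "c \<in> R \<Longrightarrow> c * x ^ k \<in> ext \<and> rep (c * x ^ k) = monom c k"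
  by (rule ext_rep_eqI) (auto simp: polys_monom poly_monom)

text \<open>\<open>R\<close> need not be a field, so \<open>f\<close> is divided only after
  multiplication by a constant: each round multiplies by the leading coefficient of \<open>g\<close>
  and then cancels the leading term of \<open>f\<close>.\<close>

lemma pseudo_division:
  assumes g: "g \<in> ext" "g \<noteq> 0"
  shows "f \<in> ext \<Longrightarrow>
    \<exists>c q r. c \<in> R \<and> c \<noteq> 0 \<and> q \<in> ext \<and> r \<in> ext \<and> c * f = q * g + r \<and> (r = 0 \<or> deg r < deg g)"
proof (induction "deg f" arbitrary: f rule: less_induct)
  case less
  show ?case
  proof (cases "f = 0 \<or> deg f < deg g")
    case True
    show ?thesis
      by (rule exI[of _ 1], rule exI[of _ 0], rule exI[of _ f])
        (use True less.prems one_closed ext_const[OF zero_closed] in auto)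
  next
    case False
    define b where "b = lead_coeff (rep g)"
    define m where "m = lead_coeff (rep f) * x ^ (deg f - deg g)"
    define h where "h = b * f - m * g"
    have b: "b \<in> R" "b \<noteq> 0" using g by (auto simp: b_def lead_in rep_eq_0)
    have m: "m \<in> ext" "rep m = monom (lead_coeff (rep f)) (deg f - deg g)"
      using ext_pow[OF lead_in[OF less.prems]] by (auto simp: m_def)
    have h: "h \<in> ext" "rep h = smult b (rep f) - rep m * rep g"
      using ext_diff ext_mult ext_const b(1) m(1) g less.prems by (auto simp: h_def)
    \<comment> \<open>For deg f = 0 the degree cannot drop any further; then \<open>f\<close> and
      \<open>g\<close> are both constants and the difference vanishes outright.\<close>
    have "h = 0 \<or> deg h < deg f"
    proof (cases "deg f = 0")
      case True
      then have "deg g = 0" using False by simp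
      then have "rep h = 0"
        using True by (auto simp: h(2) m(2) b_def monom_0 elim!: degree_eq_zeroE)
      then show ?thesis using h(1) rep_eq_0 by blast
    next
      case pos: False
      have "rep m \<noteq> 0" using False less.prems m(2) by (simp add: rep_eq_0)
      then have "degree (rep m * rep g) = deg f"
        using False g by (simp add: degree_mult_eq rep_eq_0 m(2) degree_monom_eq)
      moreover have "coeff (rep m * rep g) (deg f) = b * lead_coeff (rep f)"
        using False coeff_monom_mult[of "lead_coeff (rep f)" "deg f - deg g" "rep g" "deg f"]
        by (simp add: m(2) b_def)
      ultimately have "coeff (rep h) i = 0" if "i \<ge> deg f" for i
        using that by (cases "i = deg f") (auto simp: h(2) coeff_eq_0)
      then have "deg h < deg f" using pos
        by (metis bot_nat_0.not_eq_extremum degree_0 leading_coeff_0_iff not_le)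
      then show ?thesis ..
    qed
    then obtain c q r where c: "c \<in> R" "c \<noteq> 0" "q \<in> ext" "r \<in> ext" "c * h = q * g + r"
      "r = 0 \<or> deg r < deg g"
    proof
      assume "h = 0"
      then show ?thesis
        using that[of 1 0 0] one_closed ext_const[OF zero_closed] by auto
    next
      assume "deg h < deg f"
      then show ?thesis using less.hyps[of h] h(1) that by blast
    qed
    have "c * b * f = (q + c * m) * g + r" using c(5) by (simp add: h_def algebra_simps)
    moreover have "q + c * m \<in> ext"
      using ext_diff[of q "(0 - c) * m"] ext_mult[of "0 - c" m] ext_const[of "0 - c"]
        diff_closed[OF zero_closed c(1)] c m by auto
    moreover have "c * b \<in> R" "c * b \<noteq> 0" using c b mult_closed by auto
    ultimately show ?thesis using c(4,6) by blast
  qed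
qed

end

section \<open>Gauss' lemma and descent of constants\<close>

locale factorial_extension = free_extension +
  fixes N
  assumes ext_divisor_closed: "b \<in> ext \<Longrightarrow> b \<noteq> 0 \<Longrightarrow> a dvd b \<Longrightarrow> a \<in> ext"
    and primes: "irreducibles_prime_in R"
    and height: "divisor_height R N"
begin

lemma divisor_closed:
  assumes "b \<in> R" "b \<noteq> 0" "a dvd b" shows "a \<in> R"
proof -
  obtain c where "b = a * c" using assms by blast
  then show ?thesis
    using base_factor_closed[of a c] ext_divisor_closed[of b] ext_const[OF assms(1)] assms by auto
qed

text \<open>Induction on the height: a nonunit factor of a reducible \<open>b\<close> with nonunit
  cofactor is a proper divisor, hence of smaller height.\<close>

lemma irreducible_divisor_exists: "b \<in> R \<Longrightarrow> b \<noteq> 0 \<Longrightarrow> \<not> b dvd 1 \<Longrightarrow> \<exists>p. irreducible p \<and> p dvd b"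
proof (induction "N b" arbitrary: b rule: less_induct)
  case less
  show ?case
  proof (cases "irreducible b")
    case False
    then obtain c d where b: "b = c * d" "\<not> c dvd 1" "\<not> d dvd 1"
      using less.prems by (auto simp: irreducible_def)
    have "\<not> b dvd c" using b less.prems dvd_mult_cancel_left[of c d 1] by auto
    then have "N c < N b"
      using height less.prems b(1) unfolding divisor_height_def by (metis dvd_triv_left le_neq_implies_less)
    moreover have "c \<in> R" using divisor_closed less.prems b(1) by auto
    ultimately obtain p where "irreducible p" "p dvd c"
      using less.hyps[of c] b less.prems by auto
    then show ?thesis using b(1) by auto
  qed auto
qed

lemma ext_dvd_cases:
  assumes "b \<in> ext" "b \<noteq> 0" "a dvd b"
  obtains c where "b = a * c" "a \<in> ext" "c \<in> ext" "a \<noteq> 0" "c \<noteq> 0" "deg b = deg a + deg c"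
proof -
  obtain c where c: "b = a * c" using assms by blast
  have "a \<in> ext" "c \<in> ext" using assms ext_divisor_closed c by auto
  then show ?thesis using that[OF c] c assms deg_mult by auto
qed

lemma unit_in: "u dvd 1 \<Longrightarrow> u \<in> R"
  using divisor_closed one_closed by force

text \<open>Passing from the polynomial to its coefficients works because the cofactor lies in R[x]
  again.\<close>

lemma const_dvd_iff:
  assumes "p \<in> R" "f \<in> ext"
  shows "p dvd f \<longleftrightarrow> (\<forall>k. p dvd coeff (rep f) k)"
proof
  assume p: "p dvd f"
  show "\<forall>k. p dvd coeff (rep f) k"
  proof (cases "f = 0")
    case True
    then show ?thesis using assms rep_eq_0[of f] by simp
  next
    case False
    then obtain c where c: "f = p * c" "c \<in> ext" using ext_dvd_cases assms p by metis
    then have "rep f = [:p:] * rep c" using ext_mult[of p c] ext_const assms by auto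
    then show ?thesis by simp
  qed
next
  assume *: "\<forall>k. p dvd coeff (rep f) k"
  have "f = (\<Sum>k\<le>deg f. coeff (rep f) k * x ^ k)"
    using poly_altdef[of "rep f" x] poly_rep[OF assms(2)] by simp
  also have "p dvd \<dots>" using * by (intro dvd_sum) auto
  finally show "p dvd f" .
qed

text \<open>Gauss' lemma. Take the lowest coefficients of \<open>a\<close> and \<open>b\<close> not
  divisible by \<open>p\<close>, at \<open>k\<close> and \<open>l\<close>. In the coefficient of the
  product at \<open>k + l\<close> all terms but one are divisible by \<open>p\<close>, and primality
  of \<open>p\<close> in \<open>R\<close> gives the contradiction.\<close>

lemma const_prime:
  assumes p: "p \<in> R" "irreducible p" and ab: "a \<in> ext" "b \<in> ext" "p dvd a * b"
  shows "p dvd a \<or> p dvd b"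
proof (rule ccontr)
  assume "\<not> ?thesis"
  then have ex: "\<exists>k. \<not> p dvd coeff (rep a) k" "\<exists>k. \<not> p dvd coeff (rep b) k"
    using p ab const_dvd_iff by auto
  define k where "k = (LEAST k. \<not> p dvd coeff (rep a) k)"
  define l where "l = (LEAST k. \<not> p dvd coeff (rep b) k)"
  have below: "\<And>i. i < k \<Longrightarrow> p dvd coeff (rep a) i" "\<And>i. i < l \<Longrightarrow> p dvd coeff (rep b) i"
    using not_less_Least unfolding k_def l_def by blast+
  have at: "\<not> p dvd coeff (rep a) k" "\<not> p dvd coeff (rep b) l"
    using LeastI_ex[OF ex(1)] LeastI_ex[OF ex(2)] unfolding k_def l_def by blast+
  let ?t = "\<lambda>i. coeff (rep a) i * coeff (rep b) (k + l - i)"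
  have "p dvd coeff (rep (a * b)) (k + l)"
    using const_dvd_iff p ab ext_mult by blast
  also have "coeff (rep (a * b)) (k + l) = (\<Sum>i\<le>k + l. ?t i)"
    using ab ext_mult by (simp add: coeff_mult)
  also have "\<dots> = ?t k + (\<Sum>i\<in>{..k + l} - {k}. ?t i)"
    by (rule sum.remove) auto
  finally have "p dvd ?t k + (\<Sum>i\<in>{..k + l} - {k}. ?t i)" .
  moreover have "p dvd (\<Sum>i\<in>{..k + l} - {k}. ?t i)"
  proof (rule dvd_sum)
    fix i assume i: "i \<in> {..k + l} - {k}"
    \<comment> \<open>As i differs from k, either i lies below k, or it lies above and its partner
      index falls below l.\<close>
    then consider "i < k" | "k + l - i < l" by fastforce
    then show "p dvd ?t i"
      using below by cases (metis dvd_mult dvd_mult2)+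
  qed
  ultimately have "p dvd coeff (rep a) k * coeff (rep b) l"
    by (simp add: dvd_add_left_iff)
  then have "p dvd coeff (rep a) k \<or> p dvd coeff (rep b) l"
    using primes p rep_in ab unfolding irreducibles_prime_in_def polys_def by blast
  then show False using at by blast
qed

text \<open>Removes the constant from c f = q g by stripping irreducible factors of \<open>c\<close>
  one at a time. Each is prime by \<open>const_prime\<close>, so it cancels from \<open>q\<close> or
  from \<open>g\<close>; those taken out of \<open>g\<close> collect in \<open>d\<close>.\<close>

lemma split_const:
  "c \<in> R \<Longrightarrow> c \<noteq> 0 \<Longrightarrow> q \<in> ext \<Longrightarrow> g \<in> ext \<Longrightarrow> f \<in> ext \<Longrightarrow> c * f = q * g \<Longrightarrow>
    \<exists>d q' g'. d \<in> R \<and> d \<noteq> 0 \<and> g = d * g' \<and> f = q' * g'"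
proof (induction "N c" arbitrary: c q g rule: less_induct)
  case less
  \<comment> \<open>The case f = 0 is separate because \<open>q\<close> or \<open>g\<close> may then
    be 0, and cofactors are controlled for nonzero elements only.\<close>
  consider "f = 0" | "c dvd 1" | "f \<noteq> 0" "\<not> c dvd 1" by blast
  then show ?case
  proof cases
    case 1
    then show ?thesis using one_closed by (intro exI[of _ 1] exI[of _ 0] exI[of _ g]) auto
  next
    case 2
    then obtain u where u: "1 = c * u" by blast
    then have "f = (u * q) * g" using less.prems(6) by (metis mult.assoc mult.commute mult_1)
    then show ?thesis using one_closed by (intro exI[of _ 1] exI[of _ "u * q"] exI[of _ g]) auto
  next
    case 3
    then obtain p where p: "irreducible p" "p dvd c"
      using irreducible_divisor_exists less.prems by metis
    then obtain c' where c': "c = p * c'" by blast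
    have R: "p \<in> R" "c' \<in> R" using less.prems c' divisor_closed by auto
    have "\<not> c dvd c'" using p c' less.prems dvd_mult_cancel_right[of p c' 1] irreducible_not_unit[of p] by auto
    then have lt: "N c' < N c"
      using height less.prems c' unfolding divisor_height_def by (metis dvd_triv_right le_neq_implies_less)
    have nz: "p \<noteq> 0" "c' \<noteq> 0" "q \<noteq> 0" "g \<noteq> 0" using less.prems c' 3 by auto
    have "p dvd q * g" using less.prems(6) c' by (metis dvd_def mult.assoc)
    then consider "p dvd q" | "p dvd g" using const_prime R p less.prems by blast
    then show ?thesis
    proof cases
      case 1
      then obtain q1 where q1: "q = p * q1" "q1 \<in> ext" using ext_dvd_cases less.prems nz by metis
      then have "c' * f = q1 * g" using less.prems(6) c' nz(1) by (simp add: mult.assoc)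
      then show ?thesis using less.hyps[OF lt R(2) nz(2) q1(2)] less.prems by blast
    next
      case 2
      then obtain g1 where g1: "g = p * g1" "g1 \<in> ext" using ext_dvd_cases less.prems nz by metis
      then have "c' * f = q * g1" using less.prems(6) c' nz(1) by (simp add: mult.left_commute mult.assoc)
      then obtain d q' g' where "d \<in> R" "d \<noteq> 0" "g1 = d * g'" "f = q' * g'"
        using less.hyps[OF lt R(2) nz(2) _ g1(2)] less.prems by blast
      then show ?thesis using g1(1) mult_closed[OF R(1), of d] nz(1)
        by (intro exI[of _ "p * d"] exI[of _ q'] exI[of _ g']) (auto simp: mult.assoc)
    qed
  qed
qed

text \<open>\<open>split_const\<close> writes p = d g' with g' dividing f. A unit g' would make p
  constant, so irreducibility makes d the unit; then p divides g' and hence f.\<close>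

lemma irreducible_dvd_const_mult:
  assumes p: "p \<in> ext" "irreducible p" "deg p > 0"
    and c: "c \<in> R" "c \<noteq> 0" and f: "f \<in> ext" "p dvd c * f"
  shows "p dvd f"
proof (cases "f = 0")
  case False
  have "c * f \<in> ext" using ext_mult ext_const c f by auto
  then obtain q where q: "c * f = p * q" "q \<in> ext" using ext_dvd_cases[OF _ _ f(2)] c False by (metis mult_eq_0_iff)
  then have "c * f = q * p" by (simp add: mult.commute)
  then obtain d q' g' where d: "d \<in> R" "d \<noteq> 0" "p = d * g'" "f = q' * g'"
    using split_const[OF c q(2) p(1) f(1)] by blast
  have "\<not> g' dvd 1"
  proof
    assume "g' dvd 1"
    then have "p \<in> R" using unit_in mult_closed d by auto
    then show False using ext_const p(3) by auto
  qed
  then have "d dvd 1" using p(2) d(3) by (auto dest: irreducibleD)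
  then obtain u where "1 = d * u" by blast
  then have "g' = p * u" using d(3) by (simp add: mult_ac)
  then have "p dvd g'" by simp
  then show ?thesis using d(4) by simp
qed auto

text \<open>Among the non-multiples \<open>g\<close> of \<open>p\<close> with \<open>p\<close> dividing \<open>g * b\<close>, take one of least degree.
  Pseudo-division of \<open>g\<close> by \<open>p\<close>, or of \<open>p\<close> by \<open>g\<close>, leaves a remainder of the same kind
  and of smaller degree, which must therefore be a multiple of \<open>p\<close>.\<close>

theorem ext_irreducibles_prime: "irreducibles_prime_in ext"
  unfolding irreducibles_prime_in_def
proof (intro ballI impI, rule ccontr)
  fix p a b assume p: "p \<in> ext" "irreducible p" and ab: "a \<in> ext" "b \<in> ext" "p dvd a * b"
    and n: "\<not> (p dvd a \<or> p dvd b)"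
  have p0: "p \<noteq> 0" using p(2) by auto
  show False
  proof (cases "deg p = 0")
    case True
    then show False using const_prime deg_0_in p ab n by blast
  next
    case False
    then have dp: "deg p > 0" by simp
    define I where "I g \<longleftrightarrow> g \<in> ext \<and> p dvd g * b \<and> \<not> p dvd g" for g
    have "I a" using ab n by (simp add: I_def)
    then obtain g where g: "I g" and least: "\<And>h. I h \<Longrightarrow> deg g \<le> deg h"
      using ex_has_least_nat[of I a deg] by metis
    have g': "g \<in> ext" "p dvd g * b" "\<not> p dvd g" "g \<noteq> 0" using g by (auto simp: I_def)
    show False
    proof (cases "deg p \<le> deg g")
      case True
      obtain c q r where c: "c \<in> R" "c \<noteq> 0" "q \<in> ext" "r \<in> ext" "c * g = q * p + r"
        "r = 0 \<or> deg r < deg p"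
        using pseudo_division[OF p(1) p0 g'(1)] by blast
      have nd: "\<not> p dvd r"
        using irreducible_dvd_const_mult[OF p dp c(1,2) g'(1)] g'(3) c(5) by auto
      have "r * b = c * (g * b) - p * (q * b)" using c(5) by (simp add: algebra_simps)
      then have "p dvd r * b" using g'(2) by simp
      then have "deg g \<le> deg r" using least nd c by (simp add: I_def)
      then show False using nd c True by auto
    next
      case lt: False
      obtain c q r where c: "c \<in> R" "c \<noteq> 0" "q \<in> ext" "r \<in> ext" "c * p = q * g + r"
        "r = 0 \<or> deg r < deg g"
        using pseudo_division[OF g'(1,4) p(1)] by blast
      have "r * b = p * (c * b) - q * (g * b)" using c(5) by (simp add: algebra_simps)
      then have "p dvd r * b" using g'(2) by simp
      then have "p dvd r \<or> deg g \<le> deg r" using least[of r] c(4) by (auto simp: I_def)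
      then have "p dvd r" using c(6) by auto
      then have "deg p \<le> deg r" if "r \<noteq> 0"
        using ext_dvd_cases[OF c(4) that] by (metis le_add1)
      then have "r = 0" using c(6) lt by (cases "r = 0") auto
      \<comment> \<open>With r = 0, \<open>p\<close> and \<open>g\<close> share the factor
        \<open>g1\<close>, up to a constant in the case of \<open>g\<close>. Since deg g < deg p,
        the cofactor \<open>q'\<close> is no unit, so irreducibility makes \<open>g1\<close> one.
        Then \<open>g\<close> is a constant, and p dividing g b forces p to divide b.\<close>
      then obtain d q' g1 where d: "d \<in> R" "d \<noteq> 0" "g = d * g1" "p = q' * g1"
        using split_const[OF c(1-3) g'(1) p(1)] c(5) by auto
      have ext: "d \<in> ext" "g1 \<in> ext" "q' \<in> ext"
        using ext_const[OF d(1)] ext_divisor_closed[OF p(1) p0] d(4) by auto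
      have "deg g = deg g1" using deg_mult[of d g1] ext_const[OF d(1)] d g' ext by auto
      moreover have "deg p = deg q' + deg g1" using deg_mult d p0 ext by auto
      ultimately have "deg q' \<noteq> 0" using lt by simp
      then have "\<not> q' dvd 1" using unit_in[of q'] ext_const[of q'] by auto
      then have "g1 dvd 1" using p(2) d(4) by (auto dest: irreducibleD)
      then have "g \<in> R" using d(1,3) unit_in[of g1] mult_closed[of d g1] by simp
      then show False
        using irreducible_dvd_const_mult[OF p dp _ g'(4) ab(2)] g'(2) n by blast
    qed
  qed
qed

text \<open>Leading coefficients multiply, so neither summand can be larger for a divisor. If the
  total is unchanged, the cofactor has degree 0, equals its own leading coefficient, and the height
  on \<open>R\<close> makes that a unit.\<close>

theorem ext_divisor_height: "divisor_height ext (\<lambda>f. deg f + N (lead_coeff (rep f)))"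
  unfolding divisor_height_def
proof (intro allI impI)
  fix a b assume "b \<in> ext" "b \<noteq> 0" "a dvd b"
  then obtain c where c: "b = a * c" "a \<in> ext" "c \<in> ext" "a \<noteq> 0" "c \<noteq> 0" "deg b = deg a + deg c"
    using ext_dvd_cases by metis
  define l where "l f = lead_coeff (rep f)" for f
  have "rep b = rep a * rep c" using c(1-3) ext_mult by simp
  then have l: "l b = l a * l c" by (simp add: l_def lead_coeff_mult)
  have b: "b \<in> ext" "b \<noteq> 0" using c ext_mult by auto
  then have R: "l b \<in> R" "l b \<noteq> 0" using lead_in[of b] rep_eq_0[of b] by (auto simp: l_def)
  then have h: "N (l a) \<le> N (l b)" "N (l a) = N (l b) \<Longrightarrow> l b dvd l a"
    using height l unfolding divisor_height_def by auto
  have "b dvd a" if "deg a + N (l a) = deg b + N (l b)"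
  proof -
    have "deg c = 0" "N (l a) = N (l b)" using that h c(6) by auto
    then have "c = l c" "l b dvd l a"
      using poly_rep[OF c(3)] h by (auto simp: l_def elim!: degree_eq_zeroE)
    then have "l c dvd 1" using l R dvd_mult_cancel_left[of "l a" "l c" 1] by auto
    then obtain u where "1 = c * u" using \<open>c = l c\<close> by auto
    then have "a = b * u" using c(1) by (simp add: mult.assoc)
    then show "b dvd a" by simp
  qed
  then show "deg a + N (lead_coeff (rep a)) \<le> deg b + N (lead_coeff (rep b)) \<and>
    (deg a + N (lead_coeff (rep a)) = deg b + N (lead_coeff (rep b)) \<longrightarrow> b dvd a)"
    using h(1) c(6) by (auto simp: l_def)
qed

end

section \<open>Unique factorization in integer polynomial rings\<close>

abbreviation (input) "lookup \<equiv> Poly_Mapping.lookup"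
abbreviation (input) "single \<equiv> Poly_Mapping.single"
abbreviation (input) "keys \<equiv> Poly_Mapping.keys"

lemma poly_mapping_sum_single: "f = (\<Sum>m\<in>keys f. single m (lookup f m))"
proof (rule poly_mapping_eqI)
  fix n
  have "(\<Sum>m\<in>keys f. lookup (single m (lookup f m)) n) = (\<Sum>m\<in>keys f. if m = n then lookup f n else 0)"
    by (rule sum.cong) (auto simp: lookup_single)
  then show "lookup f n = lookup (\<Sum>m\<in>keys f. single m (lookup f m)) n"
    by (simp add: lookup_sum in_keys_iff)
qed

lemma lookup_mult_single_add:
  fixes f :: "('m::cancel_comm_monoid_add) \<Rightarrow>\<^sub>0 int"
  shows "lookup (f * single n 1) (m + n) = lookup f m"
proof -
  have "f * single n 1 = (\<Sum>k\<in>keys f. single (k + n) (lookup f k))"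
    by (subst poly_mapping_sum_single[of f]) (simp add: sum_distrib_right mult_single)
  then have "lookup (f * single n 1) (m + n) = (\<Sum>k\<in>keys f. lookup (single (k + n) (lookup f k)) (m + n))"
    by (simp add: lookup_sum)
  also have "\<dots> = (\<Sum>k\<in>keys f. lookup (single k (lookup f k)) m)"
    by (rule sum.cong) (auto simp: lookup_single when_def)
  also have "\<dots> = lookup f m"
    using arg_cong[OF poly_mapping_sum_single[of f], of "\<lambda>g. lookup g m"] by (simp add: lookup_sum)
  finally show ?thesis .
qed

section \<open>Polynomials in a prescribed set of variables\<close>

type_synonym 'i int_mpoly = "('i \<Rightarrow>\<^sub>0 nat) \<Rightarrow>\<^sub>0 int"

text \<open>The order on the index type orders the exponents compatibly with addition, which keeps
  the polynomial ring free of zero divisors.\<close>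

definition in_vars :: "'i set \<Rightarrow> 'i::linorder int_mpoly set" where
  "in_vars A = {f. \<forall>m\<in>keys f. keys m \<subseteq> A}"

definition var :: "'i \<Rightarrow> 'i::linorder int_mpoly" where
  "var i = single (single i 1) 1"

lemma keys_add_nat: "keys (m + n) = keys m \<union> keys n" for m n :: "'i \<Rightarrow>\<^sub>0 nat"
  by (auto simp: in_keys_iff lookup_add)

lemma in_vars_subring: "idom_subring (in_vars A :: 'i::linorder int_mpoly set)"
proof
  show "1 \<in> (in_vars A :: 'i int_mpoly set)" by (simp add: in_vars_def)
  fix a b :: "'i int_mpoly" assume ab: "a \<in> in_vars A" "b \<in> in_vars A"
  then show "a - b \<in> in_vars A" using keys_diff[of a b] by (auto simp: in_vars_def)
  show "a * b \<in> in_vars A" using ab keys_mult[of a b] by (fastforce simp: in_vars_def keys_add_nat)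
qed

lemma in_vars_mono: "A \<subseteq> B \<Longrightarrow> in_vars A \<subseteq> in_vars B"
  by (auto simp: in_vars_def)

lemma var_power: "var i ^ k = single (single i k) 1"
  by (induction k) (simp_all add: var_def mult_single single_add[symmetric])

text \<open>Terms are grouped by their exponent of \<open>i\<close>. Removing \<open>i\<close> from
  \<open>A\<close> in the conclusion lets the statement serve for the complement of \<open>i\<close>
  as well, where \<open>f\<close> is arbitrary.\<close>

lemma in_vars_expansion:
  assumes "f \<in> in_vars (insert i A)"
  shows "\<exists>p. (\<forall>k. coeff p k \<in> in_vars (A - {i})) \<and> f = poly p (var i)"
proof -
  interpret idom_subring "in_vars (A - {i}) :: 'a int_mpoly set" by (rule in_vars_subring)
  define rest where "rest m = m - single i (lookup m i)" for m :: "'a \<Rightarrow>\<^sub>0 nat"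
  have rest: "m = rest m + single i (lookup m i)" for m
    by (rule poly_mapping_eqI) (auto simp: rest_def lookup_add lookup_minus lookup_single when_def)
  have ki: "keys (rest m) \<subseteq> keys m - {i}" for m
    by (auto simp: in_keys_iff rest_def lookup_minus lookup_single when_def)
  define p where "p = (\<Sum>m\<in>keys f. monom (single (rest m) (lookup f m)) (lookup m i))"
  have "single (rest m) (lookup f m) \<in> in_vars (A - {i})" if "m \<in> keys f" for m
    using that assms ki[of m] by (auto simp: in_vars_def)
  then have "coeff p k \<in> in_vars (A - {i})" for k
    by (auto simp: p_def coeff_sum zero_closed intro!: sum_closed)
  moreover have "single (rest m) (lookup f m) * var i ^ lookup m i = single m (lookup f m)" for m
    using rest[of m] by (simp add: var_power mult_single)
  then have "poly p (var i) = f"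
    using poly_mapping_sum_single[of f] by (simp add: p_def poly_sum poly_monom)
  ultimately show ?thesis by metis
qed

text \<open>Let m be free of \<open>i\<close>. The coefficient of the value at m plus k times
  \<open>i\<close> comes from the k-th term alone, because the coefficients of \<open>p\<close> do
  not involve \<open>i\<close>.\<close>

lemma var_free: "free_extension (in_vars (- {i})) (var i)"
proof -
  interpret idom_subring "in_vars (- {i}) :: 'a int_mpoly set" by (rule in_vars_subring)
  show ?thesis
  proof
    fix p :: "'a int_mpoly poly"
    assume c: "\<And>k. coeff p k \<in> in_vars (- {i})" and 0: "poly p (var i) = 0"
    have "lookup (coeff p k) m = 0" for k m
    proof (cases "i \<in> keys m")
      case True
      then have "m \<notin> keys (coeff p k)" using c[of k] by (auto simp: in_vars_def)
      then show ?thesis by (simp add: in_keys_iff)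
    next
      case False
      let ?m = "m + single i k"
      have zero: "lookup (coeff p j * var i ^ j) ?m = 0" if "j \<noteq> k" for j
      proof (rule ccontr)
        assume "lookup (coeff p j * var i ^ j) ?m \<noteq> 0"
        then have "?m \<in> keys (coeff p j * var i ^ j)" by (simp add: in_keys_iff)
        then obtain m' where m': "m' \<in> keys (coeff p j)" "?m = m' + single i j"
          using keys_mult[of "coeff p j" "var i ^ j"] by (auto simp: var_power)
        then have "i \<notin> keys m'" using c[of j] by (auto simp: in_vars_def)
        then show False using arg_cong[OF m'(2), of "\<lambda>m. lookup m i"] False that
          by (simp add: in_keys_iff lookup_add)
      qed
      \<comment> \<open>The range is widened because k may exceed the degree of
        \<open>p\<close>.\<close>
      have "poly p (var i) = (\<Sum>j\<le>max k (degree p). coeff p j * var i ^ j)"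
        unfolding poly_altdef by (rule sum.mono_neutral_left) (auto simp: coeff_eq_0)
      moreover have "0 = lookup (poly p (var i)) ?m" using 0 by simp
      ultimately have "0 = (\<Sum>j\<le>max k (degree p). lookup (coeff p j * var i ^ j) ?m)"
        by (simp add: lookup_sum)
      also have "\<dots> = lookup (coeff p k * var i ^ k) ?m"
        using zero by (subst sum.remove[of _ k]) auto
      also have "\<dots> = lookup (coeff p k) m"
        by (simp add: var_power lookup_mult_single_add)
      finally show ?thesis by simp
    qed
    then show "p = 0" by (intro poly_eqI poly_mapping_eqI) simp
  qed
qed

text \<open>For each \<open>i\<close> outside \<open>A\<close>, regard the whole ring as polynomials
  in \<open>var i\<close>. There \<open>b\<close> has degree 0, so its factor \<open>a\<close> has
  degree 0 too; over all such \<open>i\<close> this leaves only the variables in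
  \<open>A\<close>.\<close>

lemma in_vars_divisor_closed:
  assumes b: "b \<in> in_vars A" "b \<noteq> 0" and a: "a dvd b"
  shows "a \<in> in_vars A"
proof -
  obtain c where c: "b = a * c" using a by blast
  have "a \<in> in_vars (- {i})" if "i \<notin> A" for i
  proof -
    interpret free_extension "in_vars (- {i})" "var i" by (rule var_free)
    have "f \<in> ext" for f
    proof -
      have "f \<in> in_vars (insert i (- {i}))" by (auto simp: in_vars_def)
      then obtain p where "\<forall>k. coeff p k \<in> in_vars (- {i} - {i})" "f = poly p (var i)"
        using in_vars_expansion by blast
      then show ?thesis by (auto simp: ext_def polys_def)
    qed
    moreover have "b \<in> in_vars (- {i})" using b that in_vars_mono[of A "- {i}"] by auto
    ultimately show ?thesis using base_factor_closed b c by blast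
  qed
  then show ?thesis by (fastforce simp: in_vars_def)
qed

section \<open>Constants, and the induction over the variables\<close>

lemma in_vars_empty: "f \<in> in_vars {} \<longleftrightarrow> (\<exists>c. f = single 0 c)"
proof
  assume "f \<in> in_vars {}"
  then have "keys f \<subseteq> {0}" by (auto simp: in_vars_def)
  then have "f = single 0 (lookup f 0)"
    by (intro poly_mapping_eqI) (auto simp: lookup_single when_def in_keys_iff)
  then show "\<exists>c. f = single 0 c" ..
qed (auto simp: in_vars_def split: if_splits)

text \<open>A cofactor of a nonzero constant is itself constant, so divisibility descends to the
  integers.\<close>

lemma single_0_dvd_iff:
  "single 0 a dvd (single 0 b :: 'i::linorder int_mpoly) \<longleftrightarrow> a dvd b"
proof
  assume dvd: "single 0 a dvd (single 0 b :: 'i int_mpoly)"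
  show "a dvd b"
  proof (cases "b = 0")
    case False
    obtain c where c: "single 0 b = single 0 a * (c :: 'i int_mpoly)" using dvd by blast
    then have "c dvd single 0 b" by simp
    then have "c \<in> in_vars {}"
      using in_vars_divisor_closed[of "single 0 b" "{}" c] False in_vars_empty
      by (metis lookup_single_eq lookup_zero)
    then obtain d where "c = single 0 d" using in_vars_empty by blast
    then have "(single 0 b :: 'i int_mpoly) = single 0 (a * d)" using c by (simp add: mult_single)
    then have "b = a * d" by (metis lookup_single_eq)
    then show ?thesis by simp
  qed auto
next
  assume "a dvd b"
  then obtain d where "b = a * d" by blast
  then have "(single 0 b :: 'i int_mpoly) = single 0 a * single 0 d" by (simp add: mult_single)
  then show "single 0 a dvd (single 0 b :: 'i int_mpoly)" by simp
qed

text \<open>Primality and height travel together: removing constants in the induction step descends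
  along the height of the smaller ring.\<close>

lemma in_vars_factorial:
  "finite A \<Longrightarrow> irreducibles_prime_in (in_vars A :: 'i::linorder int_mpoly set) \<and>
    (\<exists>N. divisor_height (in_vars A :: 'i int_mpoly set) N)"
proof (induction rule: finite_induct)
  case empty
  have unit: "single 0 u dvd (1 :: 'i int_mpoly) \<longleftrightarrow> u dvd 1" for u
    using single_0_dvd_iff[of u 1] by simp
  have "irreducibles_prime_in (in_vars {} :: 'i int_mpoly set)"
    unfolding irreducibles_prime_in_def in_vars_empty
  proof (clarsimp simp: in_vars_empty mult_single single_0_dvd_iff)
    fix p a b :: int
    assume irr: "irreducible (single 0 p :: 'i int_mpoly)" and dvd: "p dvd a * b" "\<not> p dvd b"
    have "irreducible p"
    proof (rule irreducibleI)
      show "p \<noteq> 0" using irr by auto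
      show "\<not> p dvd 1" using irr unit irreducible_not_unit by blast
      fix c d assume "p = c * d"
      then have "(single 0 p :: 'i int_mpoly) = single 0 c * single 0 d" by (simp add: mult_single)
      then show "c dvd 1 \<or> d dvd 1" using irr unit irreducibleD by blast
    qed
    then show "p dvd a"
      using dvd irreducible_imp_prime_elem prime_elem_dvd_mult_iff by blast
  qed
  \<comment> \<open>The absolute value serves as height: divisors of equal absolute value differ
    only in sign.\<close>
  moreover have "divisor_height (in_vars {} :: 'i int_mpoly set) (\<lambda>f. nat \<bar>lookup f 0\<bar>)"
    unfolding divisor_height_def
  proof (intro allI impI)
    fix a b :: "'i int_mpoly"
    assume b: "b \<in> in_vars {}" "b \<noteq> 0" and dvd: "a dvd b"
    then obtain c d where cd: "a = single 0 c" "b = single 0 d"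
      using in_vars_divisor_closed in_vars_empty by metis
    then have "c dvd d" "d \<noteq> 0" using dvd b single_0_dvd_iff by auto
    moreover have "d dvd c" if "\<bar>c\<bar> = \<bar>d\<bar>" using that by (metis abs_dvd_iff dvd_abs_iff dvd_refl)
    ultimately show "nat \<bar>lookup a 0\<bar> \<le> nat \<bar>lookup b 0\<bar> \<and>
      (nat \<bar>lookup a 0\<bar> = nat \<bar>lookup b 0\<bar> \<longrightarrow> b dvd a)"
      using dvd_imp_le_int[of d c] by (auto simp: cd single_0_dvd_iff)
  qed
  ultimately show ?case by blast
next
  case (insert i A)
  then obtain N where N: "divisor_height (in_vars A :: 'i int_mpoly set) N" by blast
  \<comment> \<open>\<open>var i\<close> is transcendental over all polynomials omitting
    \<open>i\<close>, hence over the smaller ring as well.\<close>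
  have sub: "(in_vars A :: 'i int_mpoly set) \<subseteq> in_vars (- {i})"
    using insert.hyps by (intro in_vars_mono) auto
  interpret sub: idom_subring "in_vars (insert i A) :: 'i int_mpoly set" by (rule in_vars_subring)
  interpret big: free_extension "in_vars (- {i})" "var i" by (rule var_free)
  interpret idom_subring "in_vars A :: 'i int_mpoly set" by (rule in_vars_subring)
  interpret free_extension "in_vars A" "var i"
    by unfold_locales (use big.free sub in blast)
  have ext: "ext = in_vars (insert i A)"
  proof (intro equalityI subsetI)
    fix f assume "f \<in> ext"
    then obtain p where p: "f = poly p (var i)" "\<And>k. coeff p k \<in> in_vars A"
      by (auto simp: ext_def polys_def)
    have "var i ^ k \<in> in_vars (insert i A)" for k
      by (auto simp: var_power in_vars_def)
    then show "f \<in> in_vars (insert i A)"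
      unfolding p(1) poly_altdef using p(2) in_vars_mono[of A "insert i A"]
      by (intro sub.sum_closed sub.mult_closed) auto
  next
    fix f :: "'i int_mpoly" assume "f \<in> in_vars (insert i A)"
    then show "f \<in> ext"
      using in_vars_expansion[of f i A] insert.hyps by (auto simp: ext_def polys_def)
  qed
  interpret factorial_extension "in_vars A" "var i" N
    by unfold_locales (use insert.IH N in_vars_divisor_closed in \<open>auto simp: ext\<close>)
  show ?case using ext_irreducibles_prime ext_divisor_height unfolding ext by blast
qed

section \<open>Factorization with arbitrarily many variables\<close>

lemma in_vars_self: "f \<in> in_vars (\<Union> (keys ` keys f))" "finite (\<Union> (keys ` keys f))"
  by (auto simp: in_vars_def)

theorem int_mpoly_irreducible_dvd_mult:
  fixes p :: "'i::linorder int_mpoly"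
  assumes "irreducible p" "p dvd a * b"
  shows "p dvd a \<or> p dvd b"
proof -
  let ?V = "\<lambda>f :: 'i int_mpoly. \<Union> (keys ` keys f)"
  let ?A = "?V p \<union> ?V a \<union> ?V b"
  have "irreducibles_prime_in (in_vars ?A :: 'i int_mpoly set)"
    using in_vars_factorial[of ?A] by simp
  moreover have "p \<in> in_vars ?A" "a \<in> in_vars ?A" "b \<in> in_vars ?A"
    by (auto simp: in_vars_def)
  ultimately show ?thesis using assms unfolding irreducibles_prime_in_def by blast
qed

text \<open>Heights exist per finite set of variables. That suffices, because the divisors of a
  nonzero polynomial stay within its variables: a member of \<open>Q\<close> of least height over
  the variables of \<open>x\<close> is minimal.\<close>

theorem int_mpoly_wf_proper_dvd:
  "wf {(a, b :: 'i::linorder int_mpoly). b \<noteq> 0 \<and> a dvd b \<and> \<not> b dvd a}"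
proof (rule wfI_min)
  fix x :: "'i int_mpoly" and Q assume x: "x \<in> Q"
  show "\<exists>z\<in>Q. \<forall>y. (y, z) \<in> {(a, b). b \<noteq> 0 \<and> a dvd b \<and> \<not> b dvd a} \<longrightarrow> y \<notin> Q"
  proof (cases "x = 0")
    case False
    define R where "R = (in_vars (\<Union> (keys ` keys x)) :: 'i int_mpoly set)"
    obtain N where N: "divisor_height R N"
      using in_vars_factorial[OF in_vars_self(2)[of x]] unfolding R_def by auto
    have "x \<in> R" unfolding R_def by (rule in_vars_self)
    then obtain z where z: "z \<in> Q" "z \<in> R" "z \<noteq> 0"
      and least: "\<And>y. y \<in> Q \<Longrightarrow> y \<in> R \<Longrightarrow> y \<noteq> 0 \<Longrightarrow> N z \<le> N y"
      using ex_has_least_nat[of "\<lambda>y. y \<in> Q \<and> y \<in> R \<and> y \<noteq> 0" x N] x False by blast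
    have "y \<notin> Q" if y: "y dvd z" "\<not> z dvd y" for y
    proof
      assume "y \<in> Q"
      moreover have "y \<in> R" "y \<noteq> 0" using z y in_vars_divisor_closed unfolding R_def by auto
      ultimately have "N z \<le> N y" using least by blast
      then show False using N z y unfolding divisor_height_def by (meson le_antisym)
    qed
    then show ?thesis using z by auto
  \<comment> \<open>Zero is minimal, since the relation demands a nonzero upper element.\<close>
  qed (use x in auto)
qed

lemma int_mpoly_irreducible_divisor:
  fixes y :: "'i::linorder int_mpoly"
  assumes "y \<noteq> 0" "\<not> y dvd 1"
  shows "\<exists>p. irreducible p \<and> p dvd y"
  using assms
proof (induction y rule: wf_induct_rule[OF int_mpoly_wf_proper_dvd])
  case (1 y)
  show ?case
  proof (cases "irreducible y")
    case False
    then obtain c d where y: "y = c * d" "\<not> c dvd 1" "\<not> d dvd 1"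
      using 1 by (auto simp: irreducible_def)
    then have "\<not> y dvd c" using 1 dvd_mult_cancel_left[of c d 1] by auto
    then have "\<exists>p. irreducible p \<and> p dvd c" using 1 y by auto
    then show ?thesis using y(1) by auto
  qed auto
qed

text \<open>Euclid's lemma by induction on \<open>y\<close> along proper divisors: an irreducible
  factor of \<open>y\<close> cannot divide \<open>x\<close>, so it divides \<open>z\<close> and is
  cancelled from both.\<close>

theorem int_mpoly_coprime_dvd_mult:
  fixes x y z :: "'i::linorder int_mpoly"
  assumes "\<And>d. d dvd x \<Longrightarrow> d dvd y \<Longrightarrow> d dvd 1" "y \<noteq> 0" "y dvd x * z"
  shows "y dvd z"
  using assms
proof (induction y arbitrary: z rule: wf_induct_rule[OF int_mpoly_wf_proper_dvd])
  case (1 y)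
  show ?case
  proof (cases "y dvd 1")
    case True
    then show ?thesis by (rule dvd_trans) (rule one_dvd)
  next
    case False
    obtain p where p: "irreducible p" "p dvd y"
      using int_mpoly_irreducible_divisor[OF 1(3) False] by blast
    from p(2) obtain y' where "y = p * y'" by (rule dvdE)
    with p(1) have p: "irreducible p" "y = p * y'" by auto
    have p0: "p \<noteq> 0" "y' \<noteq> 0" using p 1(3) by auto
    have "\<not> p dvd x" using p 1(2)[of p] irreducible_not_unit[of p] by auto
    moreover have "p dvd x * z" using 1(4) unfolding p(2) by (rule dvd_mult_left)
    ultimately obtain z' where z': "z = p * z'" using int_mpoly_irreducible_dvd_mult[OF p(1)] by blast
    have "\<not> y dvd y'"
      using p p0 dvd_mult_cancel_right[of p y' 1] irreducible_not_unit[of p] by auto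
    moreover have "p * y' dvd p * (x * z')" using 1(4) p(2) z' by (simp add: mult.left_commute)
    then have "y' dvd x * z'" using p0 by simp
    moreover have "y' dvd y" using p(2) by simp
    then have "d dvd 1" if "d dvd x" "d dvd y'" for d
      using 1(2)[OF that(1)] that(2) dvd_trans by metis
    ultimately have "y' dvd z'" using 1(1)[of y' z'] 1(3) p p0 by simp
    then show ?thesis using p(2) z' by simp
  qed
qed

text \<open>A unit divides 1, which contains no variable, so it is an integer dividing 1.\<close>

lemma int_mpoly_units:
  assumes "u dvd (1 :: 'i::linorder int_mpoly)"
  shows "u = 1 \<or> u = - 1"
proof -
  have "u \<in> in_vars {}"
    using in_vars_divisor_closed[of 1 "{}" u] assms by (auto simp: in_vars_def)
  then obtain c where c: "u = single 0 c" using in_vars_empty by blast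
  then have "c dvd 1" using assms single_0_dvd_iff[of c 1, where 'i = 'i] by simp
  then have "c = 1 \<or> c = - 1" by auto
  then show ?thesis using c by (auto simp: single_uminus)
qed

text \<open>Reduction to lowest terms: a divisor-minimal denominator admits no further cancellation.\<close>

lemma int_mpoly_reduced_exists:
  fixes x y :: "'i::linorder int_mpoly"
  assumes "y \<noteq> 0"
  shows "\<exists>x' y'. x * y' = x' * y \<and> y' \<noteq> 0 \<and> (\<forall>d. d dvd x' \<and> d dvd y' \<longrightarrow> d dvd 1)"
proof -
  let ?Q = "{y'. \<exists>x'. x * y' = x' * y \<and> y' \<noteq> 0}"
  have "y \<in> ?Q" using assms by auto
  with int_mpoly_wf_proper_dvd obtain y' where y': "y' \<in> ?Q"
    and min: "\<And>w. (w, y') \<in> {(a, b). b \<noteq> 0 \<and> a dvd b \<and> \<not> b dvd a} \<Longrightarrow> w \<notin> ?Q"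
    by (rule wfE_min) blast
  obtain x' where x': "x * y' = x' * y" "y' \<noteq> 0" using y' by blast
  have "d dvd 1" if "d dvd x'" "d dvd y'" for d
  proof -
    obtain u v where uv: "x' = d * u" "y' = d * v" using \<open>d dvd x'\<close> \<open>d dvd y'\<close> by blast
    then have d: "d \<noteq> 0" "v \<noteq> 0" using x' by auto
    then have "x * v = u * y" using x'(1) uv by (simp add: mult.assoc mult.left_commute)
    then have "v \<in> ?Q" using d by blast
    then have "y' dvd v" using min[of v] uv x' by auto
    then show ?thesis using d uv dvd_mult_cancel_right[of d v 1] by auto
  qed
  then show ?thesis using x' by blast
qed

section \<open>Cantor normal forms and monomials\<close>

lemma zero_less_iff: "0 < a \<longleftrightarrow> a \<noteq> 0" for a :: "'v::set_universe ordinal"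
  using zero_le_ordinal[of a] by (auto simp: le_less)

lemma times_strict_mono: "0 < a \<Longrightarrow> d < b \<Longrightarrow> a * d < a * b" for a b :: "'v::set_universe ordinal"
  using plus_strict_mono[of 0 a "a * d"] times_le_iff[of a b "a * b"] plus_zero[of "a * d"]
  by (metis less_le_trans order_refl)

lemma le_plus: "a \<le> a + b" for a b :: "'v::set_universe ordinal"
  using plus_le_iff[of a b "a + b"] by auto

lemma omega_pow_pos: "0 < omega_pow z"
proof -
  have "0 < (1 :: 'a ordinal)" unfolding one_ordinal_def by (rule less_osucc)
  then show ?thesis using omega_pow_le_iff[of z "omega_pow z"] by auto
qed

lemma omega_pow_times_less: "z < w \<Longrightarrow> omega_pow z * ord_of_nat c < omega_pow w"
  using times_strict_mono[OF omega_pow_pos, of "ord_of_nat c" omega z]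
    less_omega_iff[of "ord_of_nat c"] omega_pow_le_iff[of w "omega_pow w"]
  by (metis less_le_trans order_refl)

lemma omega_pow_strict_mono: "z < w \<Longrightarrow> omega_pow z < omega_pow w"
  using omega_pow_times_less[of z w "Suc 0"] times_one[of "omega_pow z"]
  by (simp add: one_ordinal_def)

text \<open>A strictly increasing map on a wellorder never falls below the identity: at a
  counterexample z, the induction hypothesis at \<open>omega_pow z\<close> contradicts strict
  monotonicity.\<close>

lemma le_omega_pow: "z \<le> omega_pow z"
proof (induction z rule: less_induct)
  case (less z)
  show ?case
  proof (rule ccontr)
    assume "\<not> z \<le> omega_pow z"
    then have "omega_pow z < z" by simp
    with less[OF this] omega_pow_strict_mono[OF this] show False by simp
  qed
qed

lemma ord_of_nat_mono: "m \<le> n \<Longrightarrow> ord_of_nat m \<le> (ord_of_nat n :: 'v::set_universe ordinal)"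
  by (rule lift_Suc_mono_le[of ord_of_nat]) (auto simp: less_osucc less_imp_le)

text \<open>Left subtraction: \<open>r\<close> is the least ordinal for which b + r reaches a. It
  exists because b + x is never below x.\<close>

lemma plus_difference:
  fixes a b :: "'v::set_universe ordinal"
  assumes "b \<le> a"
  shows "\<exists>r. a = b + r"
proof -
  have "x \<le> b + x" for x
  proof (induction x rule: less_induct)
    case (less x)
    show ?case
    proof (rule ccontr)
      assume "\<not> x \<le> b + x"
      then have "b + x < x" by simp
      with less[OF this] plus_strict_mono[OF this, of b] show False by simp
    qed
  qed
  then have ex: "\<exists>r. a \<le> b + r" by blast
  define r where "r = (LEAST r. a \<le> b + r)"
  have "a \<le> b + r" unfolding r_def by (rule LeastI_ex) (rule ex)
  moreover have "b + d < a" if "d < r" for d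
    using not_less_Least[of d "\<lambda>r. a \<le> b + r"] that unfolding r_def by simp
  then have "b + r \<le> a" using assms plus_le_iff by blast
  ultimately show ?thesis by (metis order_antisym)
qed

section \<open>Comparison of Cantor normal forms\<close>

definition list_coeff :: "'v::set_universe cnf_list \<Rightarrow> 'v ordinal \<Rightarrow> nat" where
  "list_coeff ts z = (case map_of ts z of None \<Rightarrow> 0 | Some c \<Rightarrow> c)"

definition lex_less :: "('v::set_universe ordinal \<Rightarrow> nat) \<Rightarrow> ('v ordinal \<Rightarrow> nat) \<Rightarrow> bool" where
  "lex_less f g \<longleftrightarrow> (\<exists>z. f z < g z \<and> (\<forall>w>z. f w = g w))"

lemma lex_less_asym: "lex_less f g \<Longrightarrow> \<not> lex_less g f"
  unfolding lex_less_def by (metis less_irrefl linorder_less_linear not_less_iff_gr_or_eq)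

lemma cnf_value_simps [simp]:
  "cnf_value [] = 0"
  "cnf_value ((z, c) # ts) = omega_pow z * ord_of_nat c + cnf_value ts"
  by (simp_all add: cnf_value_def)

lemma is_cnf_simps [simp]:
  "is_cnf []"
  "is_cnf ((z, c) # ts) \<longleftrightarrow> c > 0 \<and> (\<forall>w\<in>fst ` set ts. w < z) \<and> is_cnf ts"
  by (auto simp: is_cnf_def)

lemma list_coeff_simps [simp]:
  "list_coeff [] z = 0"
  "list_coeff ((w, c) # ts) z = (if z = w then c else list_coeff ts z)"
  by (auto simp: list_coeff_def)

lemma list_coeff_eq_0: "is_cnf ts \<Longrightarrow> list_coeff ts z = 0 \<longleftrightarrow> z \<notin> fst ` set ts"
  by (induction ts) (auto split: if_splits, force)

text \<open>By induction the tail stays below the leading power, so the value is below omega^z (c +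
  1), and every higher power of omega exceeds that.\<close>

lemma cnf_value_less:
  "is_cnf ts \<Longrightarrow> \<forall>z\<in>fst ` set ts. z < w \<Longrightarrow> cnf_value ts < omega_pow w"
proof (induction ts arbitrary: w)
  case Nil
  then show ?case by (simp add: omega_pow_pos)
next
  case (Cons t ts)
  obtain z c where t: "t = (z, c)" by fastforce
  have "cnf_value ts < omega_pow z" using Cons t by auto
  then have "cnf_value (t # ts) < omega_pow z * ord_of_nat (Suc c)"
    by (simp add: t times_osucc plus_strict_mono)
  also have "\<dots> < omega_pow w" using Cons.prems t by (intro omega_pow_times_less) auto
  finally show ?case .
qed

lemma cnf_value_less_coeff:
  assumes "is_cnf ((z, c) # ts)" "c < d"
  shows "cnf_value ((z, c) # ts) < omega_pow z * ord_of_nat d + a"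
proof -
  have "cnf_value ((z, c) # ts) < omega_pow z * ord_of_nat (Suc c)"
    using assms cnf_value_less[of ts z] by (simp add: times_osucc plus_strict_mono)
  also have "\<dots> \<le> omega_pow z * ord_of_nat d"
    using assms(2) by (intro times_mono ord_of_nat_mono) simp
  also have "\<dots> \<le> \<dots> + a" by (rule le_plus)
  finally show ?thesis .
qed

lemma omega_pow_le_term:
  assumes "d > 0"
  shows "omega_pow w \<le> omega_pow w * ord_of_nat d + a"
proof -
  have "omega_pow w = omega_pow w * ord_of_nat (Suc 0)"
    using times_one[of "omega_pow w"] by (simp add: one_ordinal_def)
  also have "\<dots> \<le> omega_pow w * ord_of_nat d"
    using assms by (intro times_mono ord_of_nat_mono) simp
  also have "\<dots> \<le> \<dots> + a" by (rule le_plus)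
  finally show ?thesis .
qed

lemma cnf_value_less_exponent:
  assumes "is_cnf ts" "\<forall>z\<in>fst ` set ts. z < w" "d > 0"
  shows "cnf_value ts < omega_pow w * ord_of_nat d + a"
  using cnf_value_less[OF assms(1,2)] omega_pow_le_term[OF assms(3)] by (rule less_le_trans)

lemma list_coeff_above: "\<forall>w\<in>fst ` set ts. w < z \<Longrightarrow> z \<le> y \<Longrightarrow> list_coeff ts y = 0"
  by (induction ts) auto

lemma lex_less_Cons_exponent:
  assumes "is_cnf ((w, d) # us)" "\<forall>z\<in>fst ` set ts. z < w"
  shows "lex_less (list_coeff ts) (list_coeff ((w, d) # us))"
  unfolding lex_less_def using assms list_coeff_above[of ts w] list_coeff_above[of us w]
  by (intro exI[of _ w]) (auto simp: less_imp_le)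

lemma lex_less_Cons_coeff:
  assumes "is_cnf ((z, c) # ts)" "is_cnf ((z, d) # us)" "c < d"
  shows "lex_less (list_coeff ((z, c) # ts)) (list_coeff ((z, d) # us))"
  unfolding lex_less_def using assms list_coeff_above[of ts z] list_coeff_above[of us z]
  by (intro exI[of _ z]) (auto simp: less_imp_le)

lemma lex_less_Cons:
  assumes "is_cnf ((z, c) # us)" "lex_less (list_coeff ts) (list_coeff us)"
  shows "lex_less (list_coeff ((z, c) # ts)) (list_coeff ((z, c) # us))"
proof -
  obtain y where y: "list_coeff ts y < list_coeff us y" "\<forall>w>y. list_coeff ts w = list_coeff us w"
    using assms(2) unfolding lex_less_def by blast
  then have "list_coeff us y \<noteq> 0" by simp
  then have "y < z" using assms(1) list_coeff_above[of us z y] by force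
  then show ?thesis unfolding lex_less_def using y by (intro exI[of _ y]) auto
qed

text \<open>Pairing the order of coefficients with the order of values in one induction gives the
  comparison and uniqueness together: equal values exclude both strict alternatives.\<close>

lemma cnf_trichotomy:
  "is_cnf ts \<Longrightarrow> is_cnf us \<Longrightarrow> ts = us \<or>
    lex_less (list_coeff ts) (list_coeff us) \<and> cnf_value ts < cnf_value us \<or>
    lex_less (list_coeff us) (list_coeff ts) \<and> cnf_value us < cnf_value ts"
proof (induction ts arbitrary: us)
  case Nil
  show ?case
  proof (cases us)
    case (Cons u us')
    obtain w d where u: "u = (w, d)" by fastforce
    show ?thesis
      using lex_less_Cons_exponent[of w d us' "[]"] cnf_value_less_exponent[of "[]" w d] Nil Cons u
      by (simp del: list_coeff_simps)
  qed simp
next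
  case (Cons t ts)
  obtain z c where t: "t = (z, c)" by fastforce
  show ?case
  proof (cases us)
    case Nil
    then show ?thesis
      using lex_less_Cons_exponent[of z c ts "[]"] cnf_value_less_exponent[of "[]" z c] Cons t
      by (simp del: list_coeff_simps)
  next
    case us: (Cons u us')
    obtain w d where u: "u = (w, d)" by fastforce
    have c: "is_cnf ((z, c) # ts)" "is_cnf ((w, d) # us')" using Cons.prems t us u by simp_all
    consider "z < w" | "w < z" | "z = w" "c < d" | "z = w" "d < c" | "z = w" "c = d"
      by fastforce
    then show ?thesis
    proof cases
      case 1
      then have "\<forall>y\<in>fst ` set ((z, c) # ts). y < w" using c by auto
      then show ?thesis
        using lex_less_Cons_exponent[OF c(2)] cnf_value_less_exponent[OF c(1)] c
        by (simp add: t us u del: list_coeff_simps)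
    next
      case 2
      then have "\<forall>y\<in>fst ` set ((w, d) # us'). y < z" using c by auto
      then show ?thesis
        using lex_less_Cons_exponent[OF c(1)] cnf_value_less_exponent[OF c(2)] c
        by (simp add: t us u del: list_coeff_simps)
    next
      case 3
      then show ?thesis
        using lex_less_Cons_coeff[of z c ts d us'] c cnf_value_less_coeff[OF c(1)] by (simp add: t us u del: list_coeff_simps)
    next
      case 4
      then show ?thesis
        using lex_less_Cons_coeff[of w d us' c ts] c cnf_value_less_coeff[OF c(2)] by (simp add: t us u del: list_coeff_simps)
    next
      case 5
      then show ?thesis
        using Cons.IH[of us'] lex_less_Cons[of z c us' ts] lex_less_Cons[of z c ts us'] c
          plus_strict_mono[of "cnf_value ts" "cnf_value us'" "omega_pow z * ord_of_nat c"]
          plus_strict_mono[of "cnf_value us'" "cnf_value ts" "omega_pow z * ord_of_nat c"]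
        by (auto simp: t us u simp del: list_coeff_simps)
    qed
  qed
qed

lemma cnf_value_less_iff:
  "is_cnf ts \<Longrightarrow> is_cnf us \<Longrightarrow> cnf_value ts < cnf_value us \<longleftrightarrow> lex_less (list_coeff ts) (list_coeff us)"
  using cnf_trichotomy[of ts us] lex_less_asym[of "list_coeff ts" "list_coeff us"]
  by (auto simp: lex_less_def)

section \<open>Existence of Cantor normal forms\<close>

lemma leading_exponent:
  assumes "a \<noteq> 0"
  shows "\<exists>z. omega_pow z \<le> a \<and> a < omega_pow (osucc z)"
proof -
  have ex: "\<exists>y. a < omega_pow y"
    using le_omega_pow[of "osucc a"] less_osucc[of a] by (metis less_le_trans)
  \<comment> \<open>This y is not 0 because a is positive, and not a limit because omega^y would
    then be a supremum of powers that are at most a. So it is a successor, and its predecessor is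
    the exponent sought.\<close>
  define y where "y = (LEAST y. a < omega_pow y)"
  have y: "a < omega_pow y" unfolding y_def by (rule LeastI_ex) (rule ex)
  have below: "omega_pow z \<le> a" if "z < y" for z
    using not_less_Least[of z "\<lambda>y. a < omega_pow y"] that unfolding y_def by simp
  have "1 \<le> a" using assms osucc_le_iff[of 0 a] by (simp add: one_ordinal_def zero_less_iff)
  then have "y \<noteq> 0" using y by (auto simp: omega_pow_zero)
  moreover have "\<not> is_limit y"
    using y below osup_image_le_iff[of omega_pow y a] by (auto simp: omega_pow_limit)
  ultimately obtain z where "y = osucc z" using ordinal_cases by blast
  then show ?thesis using y below[of z] less_osucc by blast
qed

text \<open>Multiplication is continuous at omega, so a lies below omega^z n for some natural n. The
  coefficient is one less than the least such n, and left subtraction supplies the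
  remainder.\<close>

lemma leading_term:
  assumes "a \<noteq> 0"
  shows "\<exists>z c r. c > 0 \<and> a = omega_pow z * ord_of_nat c + r \<and> r < omega_pow z \<and> omega_pow z \<le> a"
proof -
  obtain z where z: "omega_pow z \<le> a" "a < omega_pow z * omega"
    using leading_exponent[OF assms] by (auto simp: omega_pow_osucc)
  have "is_limit (omega :: 'a ordinal)"
    unfolding is_limit_def
    using less_omega_iff[of "0 :: 'a ordinal"] less_omega_iff ord_of_nat.simps
    by (metis less_irrefl)
  then have "\<exists>n. a < omega_pow z * ord_of_nat n"
    using z(2) osup_image_le_iff[of "\<lambda>d. omega_pow z * d" omega a] times_limit[of omega "omega_pow z"]
    by (metis less_omega_iff not_le)
  then obtain n where n: "a < omega_pow z * ord_of_nat n"
    and least: "\<And>m. a < omega_pow z * ord_of_nat m \<Longrightarrow> n \<le> m"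
    using ex_has_least_nat[of "\<lambda>n. a < omega_pow z * ord_of_nat n" _ id] by auto
  have "n \<noteq> 0"
  proof
    assume "n = 0"
    then have "a < 0" using n by (simp add: times_zero)
    then show False using zero_le_ordinal[of a] by simp
  qed
  then obtain c where c: "n = Suc c" using not0_implies_Suc by blast
  have le: "omega_pow z * ord_of_nat c \<le> a" using least[of c] c by (metis Suc_n_not_le_n not_le)
  then obtain r where r: "a = omega_pow z * ord_of_nat c + r" using plus_difference by blast
  have "r < omega_pow z"
  proof (rule ccontr)
    assume "\<not> r < omega_pow z"
    then have "omega_pow z * ord_of_nat c + omega_pow z \<le> a"
      unfolding r using plus_strict_mono by (metis le_less not_le)
    then show False using n by (simp add: c times_osucc)
  qed
  moreover have "c \<noteq> 0"
  proof
    assume "c = 0"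
    then have "n = Suc 0" using c by simp
    then have "a < omega_pow z" using n times_one[of "omega_pow z"] by (simp add: one_ordinal_def)
    then show False using z(1) by simp
  qed
  ultimately show ?thesis using r z(1) by blast
qed

lemma cnf_exists: "\<exists>ts. is_cnf ts \<and> cnf_value ts = a"
proof (induction a rule: less_induct)
  case (less a)
  show ?case
  proof (cases "a = 0")
    case True
    then show ?thesis by (intro exI[of _ "[]"]) simp
  next
    case False
    then obtain z c r where zcr: "c > 0" "a = omega_pow z * ord_of_nat c + r" "r < omega_pow z"
      "omega_pow z \<le> a"
      using leading_term by blast
    then have "r < a" by (metis less_le_trans)
    then obtain ts where ts: "is_cnf ts" "cnf_value ts = r" using less[of r] by blast
    \<comment> \<open>Exponents decrease along the list, so bounding the first one is enough; its
      power of omega is at most the value r, which is below omega^z.\<close>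
    have "w < z" if "w \<in> fst ` set ts" for w
    proof (cases ts)
      case (Cons t us)
      obtain y d where t: "t = (y, d)" by fastforce
      have "y < z"
      proof (rule ccontr)
        assume "\<not> y < z"
        then have "omega_pow z \<le> omega_pow y" by (intro omega_pow_mono) simp
        also have "\<dots> \<le> cnf_value ts"
          using omega_pow_le_term[of d y] ts(1) Cons t by simp
        finally show False using ts(2) zcr(3) by simp
      qed
      then show ?thesis using that ts(1) Cons t by auto
    qed (use that in simp)
    then show ?thesis using ts zcr by (intro exI[of _ "(z, c) # ts"]) auto
  qed
qed

lemma cnf_spec: "is_cnf (cnf a)" "cnf_value (cnf a) = a"
proof -
  obtain ts where ts: "is_cnf ts" "cnf_value ts = a" using cnf_exists by blast
  then have "cnf a = ts" unfolding cnf_def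
    using cnf_trichotomy by (intro the_equality) fastforce+
  with ts show "is_cnf (cnf a)" "cnf_value (cnf a) = a" by simp_all
qed

lemma cnf_cnf_value: "is_cnf ts \<Longrightarrow> cnf (cnf_value ts) = ts"
  using cnf_trichotomy[of ts "cnf (cnf_value ts)"] by (auto simp: cnf_spec)

lemma cnf_coeff_eq: "cnf_coeff a = list_coeff (cnf a)"
  by (simp add: fun_eq_iff cnf_coeff_def list_coeff_def)

theorem ordinal_less_iff: "a < b \<longleftrightarrow> lex_less (cnf_coeff a) (cnf_coeff b)"
  using cnf_value_less_iff[OF cnf_spec(1)[of a] cnf_spec(1)[of b]] unfolding cnf_spec(2) cnf_coeff_eq .

lemma cnf_coeff_inject: "cnf_coeff a = cnf_coeff b \<longleftrightarrow> a = b"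
proof
  assume "cnf_coeff a = cnf_coeff b"
  then have "\<not> a < b" "\<not> b < a"
    unfolding ordinal_less_iff[of a b] ordinal_less_iff[of b a] by (simp_all add: lex_less_def)
  then show "a = b" by simp
qed simp

lemma cnf_exponents_eq: "cnf_exponents a = {z. cnf_coeff a z \<noteq> 0}"
  using list_coeff_eq_0[OF cnf_spec(1)[of a]] by (auto simp: cnf_exponents_def cnf_coeff_eq)

lemma finite_cnf_coeff: "finite {z. cnf_coeff a z \<noteq> 0}"
  using cnf_exponents_eq[of a] by (metis List.finite_set cnf_exponents_def finite_imageI)

text \<open>Listing the support in decreasing order gives a normal form. Existence here is what
  gives the definite descriptions in \<open>natural_sum\<close> and \<open>surint_of\<close> their
  meaning.\<close>

lemma cnf_coeff_surj:
  assumes "finite {z. g z \<noteq> 0}"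
  shows "\<exists>a. cnf_coeff a = g"
proof -
  define ts where "ts = map (\<lambda>z. (z, g z)) (rev (sorted_list_of_set {z. g z \<noteq> 0}))"
  have map: "map fst ts = rev (sorted_list_of_set {z. g z \<noteq> 0})" by (simp add: ts_def comp_def)
  have "sorted_wrt (>) (map fst ts)"
    unfolding map sorted_wrt_rev by simp
  then have cnf: "is_cnf ts" using assms by (auto simp: is_cnf_def ts_def)
  have "list_coeff ts z = g z" for z
  proof (cases "g z = 0")
    case True
    then show ?thesis using list_coeff_eq_0[OF cnf, of z] assms by (auto simp: ts_def)
  next
    case False
    then have "(z, g z) \<in> set ts" using assms by (auto simp: ts_def)
    moreover have "distinct (map fst ts)" unfolding map by simp
    ultimately show ?thesis by (simp add: list_coeff_def)
  qed
  then have "cnf_coeff (cnf_value ts) = g" by (auto simp: cnf_coeff_eq cnf_cnf_value[OF cnf])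
  then show ?thesis ..
qed

lemma cnf_coeff_natural_sum: "cnf_coeff (natural_sum a b) z = cnf_coeff a z + cnf_coeff b z"
proof -
  have "finite ({z. cnf_coeff a z \<noteq> 0} \<union> {z. cnf_coeff b z \<noteq> 0})" by (intro finite_UnI finite_cnf_coeff)
  then have "finite {z. cnf_coeff a z + cnf_coeff b z \<noteq> 0}" by (rule rev_finite_subset) auto
  then obtain g where g: "cnf_coeff g = (\<lambda>z. cnf_coeff a z + cnf_coeff b z)"
    using cnf_coeff_surj[of "\<lambda>z. cnf_coeff a z + cnf_coeff b z"] by blast
  then have "natural_sum a b = g" unfolding natural_sum_def
    by (intro the_equality) (auto simp: fun_eq_iff simp flip: cnf_coeff_inject)
  then show ?thesis using g by simp
qed

instance dual :: (linorder) linorder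
  by intro_classes (simp add: dual_less_eq_iff linear)

text \<open>Exponents are dualized because the library order on finitely supported functions compares
  values at the least differing argument, whereas Cantor normal forms are compared at the
  greatest differing exponent.\<close>

definition monomial :: "'v::set_universe ordinal \<Rightarrow> 'v ordinal dual \<Rightarrow>\<^sub>0 nat" where
  "monomial a = Abs_poly_mapping (\<lambda>z. cnf_coeff a (undual z))"

lemma lookup_monomial: "lookup (monomial a) z = cnf_coeff a (undual z)"
proof -
  have "finite (undual -` {z. cnf_coeff a z \<noteq> 0})"
    by (intro finite_vimageI finite_cnf_coeff inj_undual)
  then show ?thesis by (simp add: monomial_def vimage_def)
qed

lemma monomial_less_iff: "monomial a < monomial b \<longleftrightarrow> a < b"
proof -
  have "monomial a < monomial b \<longleftrightarrow> (\<exists>z. cnf_coeff a (undual z) < cnf_coeff b (undual z) \<and>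
      (\<forall>w<z. cnf_coeff a (undual w) = cnf_coeff b (undual w)))"
    by (simp add: less_poly_mapping.rep_eq less_fun_def lookup_monomial)
  also have "\<dots> \<longleftrightarrow> lex_less (cnf_coeff a) (cnf_coeff b)"
    unfolding lex_less_def by (metis dual_less_iff undual_dual)
  finally show ?thesis by (simp only: ordinal_less_iff[of a b])
qed

lemma monomial_inject: "monomial a = monomial b \<longleftrightarrow> a = b"
  by (metis less_irrefl monomial_less_iff not_less_iff_gr_or_eq)

lemma monomial_surj: "\<exists>a. m = monomial a"
proof -
  have "{z. lookup m (dual z) \<noteq> 0} = dual -` keys m" by (auto simp: in_keys_iff)
  then have "finite {z. lookup m (dual z) \<noteq> 0}" by (simp add: finite_vimageI inj_dual)
  then obtain a where "cnf_coeff a = (\<lambda>z. lookup m (dual z))" using cnf_coeff_surj[of "\<lambda>z. lookup m (dual z)"] by blast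
  then have "m = monomial a" by (intro poly_mapping_eqI) (simp add: lookup_monomial)
  then show ?thesis ..
qed

lemma monomial_natural_sum: "monomial (natural_sum a b) = monomial a + monomial b"
  by (rule poly_mapping_eqI) (simp add: lookup_monomial lookup_add cnf_coeff_natural_sum)

lemma cnf_coeff_0: "cnf_coeff 0 (z :: 'v::set_universe ordinal) = 0"
  using cnf_cnf_value[of "[] :: 'v cnf_list"] by (simp add: cnf_coeff_eq)

lemma cnf_coeff_1: "cnf_coeff 1 z = (if z = 0 then 1 else 0)"
proof -
  have "cnf_value [(0, 1)] = (1 :: 'a ordinal)"
    using times_one[of "1 :: 'a ordinal"] by (simp add: omega_pow_zero plus_zero one_ordinal_def)
  then have "cnf (1 :: 'a ordinal) = [(0, 1)]" using cnf_cnf_value[of "[(0, 1)] :: 'a cnf_list"] by simp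
  then show ?thesis by (simp add: cnf_coeff_eq)
qed

lemma monomial_0: "monomial 0 = 0"
  by (rule poly_mapping_eqI) (simp add: lookup_monomial cnf_coeff_0)

section \<open>Surintegers as polynomials and surrationals as fractions\<close>

text \<open>The convolution as one finite sum over pairs of keys, the shape in which
  \<open>zmul\<close> is defined.\<close>

lemma lookup_times_keys:
  fixes f g :: "'m::monoid_add \<Rightarrow>\<^sub>0 int"
  shows "lookup (f * g) k = (\<Sum>(m, n)\<in>keys f \<times> keys g. if m + n = k then lookup f m * lookup g n else 0)"
proof -
  have "f * g = (\<Sum>m\<in>keys f. single m (lookup f m)) * (\<Sum>n\<in>keys g. single n (lookup g n))"
    using poly_mapping_sum_single by metis
  also have "\<dots> = (\<Sum>(m, n)\<in>keys f \<times> keys g. single (m + n) (lookup f m * lookup g n))"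
    by (simp add: sum_product sum.cartesian_product mult_single)
  finally have *: "f * g = (\<Sum>(m, n)\<in>keys f \<times> keys g. single (m + n) (lookup f m * lookup g n))" .
  show ?thesis unfolding * lookup_sum
    by (rule sum.cong) (auto simp: lookup_single when_def)
qed

section \<open>The sign of the leading coefficient\<close>

definition positive :: "('m::linorder \<Rightarrow>\<^sub>0 int) \<Rightarrow> bool" where
  "positive f \<longleftrightarrow> (\<exists>m. lookup f m > 0 \<and> (\<forall>n>m. lookup f n = 0))"

lemma positive_add:
  assumes "positive f" "positive g"
  shows "positive (f + g)"
proof -
  obtain m n where *: "lookup f m > 0" "\<forall>k>m. lookup f k = 0" "lookup g n > 0" "\<forall>k>n. lookup g k = 0"
    using assms unfolding positive_def by blast
  then show ?thesis unfolding positive_def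
    by (intro exI[of _ "max m n"]) (cases m n rule: linorder_cases; auto simp: lookup_add max_def)
qed

text \<open>Addition of exponents is strictly monotone, so the two leading exponents are the only
  keys adding up to \<open>m + n\<close>, and all other sums of keys are smaller.\<close>

lemma positive_mult:
  fixes f g :: "('m::{ordered_cancel_comm_monoid_add, linorder}) \<Rightarrow>\<^sub>0 int"
  assumes "positive f" "positive g"
  shows "positive (f * g)"
proof -
  obtain m n where m: "lookup f m > 0" "\<forall>k>m. lookup f k = 0"
    and n: "lookup g n > 0" "\<forall>k>n. lookup g k = 0"
    using assms unfolding positive_def by blast
  have le: "a \<le> m" "b \<le> n" if "a \<in> keys f" "b \<in> keys g" for a b
    using m n that by (auto simp: in_keys_iff intro: leI)
  have "lookup (f * g) (m + n) = (\<Sum>p\<in>keys f \<times> keys g. if p = (m, n) then lookup f m * lookup g n else 0)"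
    unfolding lookup_times_keys
  proof (rule sum.cong)
    fix p assume p: "p \<in> keys f \<times> keys g"
    obtain a b where ab: "p = (a, b)" by fastforce
    have "a = m \<and> b = n" if "a + b = m + n"
      using le[of a b] p ab that add_less_le_mono[of a m b n] add_le_less_mono[of a m b n]
      by (auto simp: le_less)
    then show "(case p of (a, b) \<Rightarrow> if a + b = m + n then lookup f a * lookup g b else 0) =
      (if p = (m, n) then lookup f m * lookup g n else 0)" by (auto simp: ab)
  qed simp
  also have "\<dots> = lookup f m * lookup g n" using m n by (auto simp: in_keys_iff)
  finally have "lookup (f * g) (m + n) > 0" using m n by simp
  moreover have "lookup (f * g) k = 0" if "k > m + n" for k
    unfolding lookup_times_keys
  proof (rule sum.neutral, clarify)
    fix a b assume "a \<in> keys f" "b \<in> keys g"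
    then have "a + b \<le> m + n" using le by (intro add_mono)
    then show "(if a + b = k then lookup f a * lookup g b else 0) = 0" using that by auto
  qed
  ultimately show ?thesis unfolding positive_def by blast
qed

lemma positive_total: "f = 0 \<or> positive f \<or> positive (- f)"
proof (cases "f = 0")
  case False
  then have *: "keys f \<noteq> {}" by simp
  define m where "m = Max (keys f)"
  have "lookup f m \<noteq> 0" using Max_in[OF finite_keys *] by (simp add: m_def in_keys_iff)
  moreover have "lookup f n = 0" if "n > m" for n
    using that Max_ge[OF finite_keys, of n f] by (auto simp: m_def in_keys_iff not_le[symmetric])
  ultimately show ?thesis unfolding positive_def
    by (metis lookup_uminus neg_0_less_iff_less neg_equal_0_iff_equal not_less_iff_gr_or_eq)
qed simp

lemma not_positive_0: "\<not> positive 0"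
  by (simp add: positive_def)

lemma positive_minus: "positive f \<Longrightarrow> \<not> positive (- f)"
  using positive_add[of f "- f"] not_positive_0 by auto

lemma positive_1: "positive (1 :: ('m::{ordered_cancel_comm_monoid_add, linorder}) \<Rightarrow>\<^sub>0 int)"
  unfolding positive_def by (intro exI[of _ 0]) (auto simp: lookup_one when_def)

section \<open>The isomorphism between surintegers and polynomials\<close>

type_synonym 'v int_mpoly_dual = "'v ordinal dual int_mpoly"

text \<open>\<open>monomial\<close> is a bijection, and its inverse reads a monomial back as an
  exponent. The map is defined on all pairs of ordinals, so the laws for the operations hold without
  membership assumptions; on \<open>surints\<close> it is injective.\<close>

definition to_mpoly :: "'v::set_universe surint \<Rightarrow> 'v int_mpoly_dual" where
  "to_mpoly a = Abs_poly_mapping (\<lambda>m. Defs.coeff a (inv monomial m))"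

definition from_mpoly :: "'v::set_universe int_mpoly_dual \<Rightarrow> 'v surint" where
  "from_mpoly f = surint_of (\<lambda>z. lookup f (monomial z))"

lemma inv_monomial: "inv monomial (monomial a) = a"
  by (simp add: inv_f_f inj_def monomial_inject)

lemma monomial_inv: "monomial (inv monomial m) = m"
  using monomial_surj by (metis inv_monomial)

lemma finite_coeff: "finite {z. Defs.coeff a z \<noteq> 0}"
proof (rule finite_subset)
  show "{z. Defs.coeff a z \<noteq> 0} \<subseteq> {z. cnf_coeff (snd a) z \<noteq> 0} \<union> {z. cnf_coeff (fst a) z \<noteq> 0}"
    by (auto simp: Defs.coeff_def)
qed (simp add: finite_cnf_coeff del: neq0_conv)

lemma lookup_to_mpoly: "lookup (to_mpoly a) (monomial z) = Defs.coeff a z"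
proof -
  have "{m. Defs.coeff a (inv monomial m) \<noteq> 0} \<subseteq> monomial ` {z. Defs.coeff a z \<noteq> 0}"
    using monomial_inv by (metis (mono_tags, lifting) image_eqI mem_Collect_eq subsetI)
  then have "finite {m. Defs.coeff a (inv monomial m) \<noteq> 0}" using finite_coeff finite_surj by blast
  then show ?thesis by (simp add: to_mpoly_def inv_monomial)
qed

lemma mpoly_eqI: "(\<And>z. lookup f (monomial z) = lookup g (monomial z)) \<Longrightarrow> f = g"
  by (metis monomial_inv poly_mapping_eqI)

text \<open>Disjoint exponents mean that one of the two coefficients vanishes everywhere, so both
  are recovered from their difference as its negative and positive part.\<close>

lemma surints_coeff:
  assumes "a \<in> surints"
  shows "cnf_coeff (fst a) z = nat (- Defs.coeff a z)" "cnf_coeff (snd a) z = nat (Defs.coeff a z)"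
proof -
  have "cnf_coeff (fst a) z = 0 \<or> cnf_coeff (snd a) z = 0"
    using assms by (auto simp: surints_def cnf_exponents_eq)
  then show "cnf_coeff (fst a) z = nat (- Defs.coeff a z)" "cnf_coeff (snd a) z = nat (Defs.coeff a z)"
    by (auto simp: Defs.coeff_def)
qed

lemma surints_eqI:
  assumes "a \<in> surints" "b \<in> surints" "Defs.coeff a = Defs.coeff b"
  shows "a = b"
  using surints_coeff[OF assms(1)] surints_coeff[OF assms(2)] assms(3)
  by (intro prod_eqI cnf_coeff_inject[THEN iffD1] ext) auto

lemma surint_of_props:
  assumes "finite {z. f z \<noteq> 0}"
  shows "surint_of f \<in> surints" "Defs.coeff (surint_of f) = f"
proof -
  have "finite {z. nat (f z) \<noteq> 0}" "finite {z. nat (- f z) \<noteq> 0}"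
    by (auto intro: finite_subset[OF _ assms])
  then obtain b a where ab: "cnf_coeff b = (\<lambda>z. nat (f z))" "cnf_coeff a = (\<lambda>z. nat (- f z))"
    using cnf_coeff_surj[of "\<lambda>z. nat (f z)"] cnf_coeff_surj[of "\<lambda>z. nat (- f z)"] by blast
  then have *: "(a, b) \<in> surints" "Defs.coeff (a, b) = f"
    by (auto simp: surints_def cnf_exponents_eq Defs.coeff_def)
  have "surint_of f = (a, b)"
    unfolding surint_of_def by (rule the_equality) (use * surints_eqI in metis)+
  then show "surint_of f \<in> surints" "Defs.coeff (surint_of f) = f" using * by simp_all
qed

lemma from_mpoly_props: "from_mpoly f \<in> surints" "Defs.coeff (from_mpoly f) z = lookup f (monomial z)"
proof -
  have "{z. lookup f (monomial z) \<noteq> 0} = monomial -` keys f" by (auto simp: in_keys_iff)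
  then have "finite {z. lookup f (monomial z) \<noteq> 0}"
    by (simp add: finite_vimageI inj_def monomial_inject)
  then show "from_mpoly f \<in> surints" "Defs.coeff (from_mpoly f) z = lookup f (monomial z)"
    unfolding from_mpoly_def by (simp_all add: surint_of_props)
qed

lemma to_from_mpoly: "to_mpoly (from_mpoly f) = f"
  by (rule mpoly_eqI) (simp add: lookup_to_mpoly from_mpoly_props)

lemma from_to_mpoly: "a \<in> surints \<Longrightarrow> from_mpoly (to_mpoly a) = a"
  by (rule surints_eqI) (auto simp: lookup_to_mpoly from_mpoly_props)

lemma to_mpoly_inject: "a \<in> surints \<Longrightarrow> b \<in> surints \<Longrightarrow> to_mpoly a = to_mpoly b \<longleftrightarrow> a = b"
  by (metis from_to_mpoly)

lemma zadd_eq: "a +\<^sub>Z b = from_mpoly (to_mpoly a + to_mpoly b)"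
  by (simp add: zadd_def from_mpoly_def lookup_add lookup_to_mpoly)

text \<open>Reindexing the pairs of keys along \<open>monomial\<close> turns the condition on the
  sum of monomials into the condition on the natural sum of exponents.\<close>

lemma zmul_eq: "a *\<^sub>Z b = from_mpoly (to_mpoly a * to_mpoly b)"
proof -
  have "(\<Sum>(z, e) | Defs.coeff a z \<noteq> 0 \<and> Defs.coeff b e \<noteq> 0 \<and> natural_sum z e = t. Defs.coeff a z * Defs.coeff b e) =
      lookup (to_mpoly a * to_mpoly b) (monomial t)" for t
  proof -
    let ?A = "{z. Defs.coeff a z \<noteq> 0}" and ?B = "{z. Defs.coeff b z \<noteq> 0}"
    have keys: "keys (to_mpoly c) = monomial ` {z. Defs.coeff c z \<noteq> 0}" for c :: "'a surint"
      using monomial_surj by (fastforce simp: in_keys_iff lookup_to_mpoly)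
    have "lookup (to_mpoly a * to_mpoly b) (monomial t) = (\<Sum>(m, n)\<in>map_prod monomial monomial ` (?A \<times> ?B).
        if m + n = monomial t then lookup (to_mpoly a) m * lookup (to_mpoly b) n else 0)"
      by (simp add: lookup_times_keys keys map_prod_surj_on[OF refl refl])
    also have "\<dots> = (\<Sum>(z, e)\<in>?A \<times> ?B. if natural_sum z e = t then Defs.coeff a z * Defs.coeff b e else 0)"
      by (subst sum.reindex)
        (auto intro!: inj_onI sum.cong simp: monomial_inject lookup_to_mpoly case_prod_beta
          simp flip: monomial_natural_sum)
    also have "\<dots> = (\<Sum>(z, e)\<in>{p \<in> ?A \<times> ?B. natural_sum (fst p) (snd p) = t}. Defs.coeff a z * Defs.coeff b e)"
      by (subst sum.inter_filter) (auto simp: finite_coeff intro!: sum.cong)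
    also have "{p \<in> ?A \<times> ?B. natural_sum (fst p) (snd p) = t} =
        {(z, e). Defs.coeff a z \<noteq> 0 \<and> Defs.coeff b e \<noteq> 0 \<and> natural_sum z e = t}" by auto
    finally show ?thesis by simp
  qed
  then show ?thesis by (simp add: zmul_def from_mpoly_def)
qed

lemma surint_ops_closed: "a +\<^sub>Z b \<in> surints" "a *\<^sub>Z b \<in> surints"
  by (simp_all add: zadd_eq zmul_eq from_mpoly_props)

lemma zneg_closed: "a \<in> surints \<Longrightarrow> -\<^sub>Z a \<in> surints"
  by (auto simp: surints_def zneg_def)

lemma to_mpoly_simps:
  "to_mpoly (a +\<^sub>Z b) = to_mpoly a + to_mpoly b"
  "to_mpoly (a *\<^sub>Z b) = to_mpoly a * to_mpoly b"
  "to_mpoly (-\<^sub>Z a) = - to_mpoly a"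
  by (simp_all add: zadd_eq zmul_eq to_from_mpoly)
    (rule mpoly_eqI, simp add: lookup_to_mpoly Defs.coeff_def zneg_def)

lemma zzero_in: "zzero \<in> surints" and to_mpoly_zzero: "to_mpoly zzero = 0"
  by (simp_all add: zzero_def surints_def cnf_exponents_eq cnf_coeff_0)
    (rule mpoly_eqI, simp add: lookup_to_mpoly Defs.coeff_def cnf_coeff_0)

lemma zone_in: "zone \<in> surints" and to_mpoly_zone: "to_mpoly zone = 1"
proof -
  show "zone \<in> surints" by (simp add: zone_def surints_def cnf_exponents_eq cnf_coeff_0)
  show "to_mpoly zone = 1"
    by (rule mpoly_eqI)
      (simp add: zone_def lookup_to_mpoly Defs.coeff_def cnf_coeff_0 cnf_coeff_1 lookup_one when_def
        monomial_inject flip: monomial_0)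
qed

lemma to_mpoly_eq_0: "a \<in> surints \<Longrightarrow> to_mpoly a = 0 \<longleftrightarrow> a = zzero"
  using to_mpoly_inject[OF _ zzero_in] by (simp add: to_mpoly_zzero)

text \<open>The leading exponent is the greatest one at which the two coordinates differ, and the
  sign there tells which has the larger coefficient. This is the comparison of ordinals in
  \<open>ordinal_less_iff\<close>.\<close>

lemma positive_to_mpoly: "positive (to_mpoly a) \<longleftrightarrow> fst a < snd a"
proof -
  have "positive (to_mpoly a) \<longleftrightarrow> (\<exists>z. Defs.coeff a z > 0 \<and> (\<forall>w>z. Defs.coeff a w = 0))"
  proof
    assume "positive (to_mpoly a)"
    then obtain m where m: "lookup (to_mpoly a) m > 0" "\<forall>n>m. lookup (to_mpoly a) n = 0"
      unfolding positive_def by blast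
    obtain z where z: "m = monomial z" using monomial_surj by blast
    have "Defs.coeff a w = 0" if "w > z" for w
      using m(2) that by (simp add: z monomial_less_iff flip: lookup_to_mpoly)
    moreover have "Defs.coeff a z > 0" using m(1) by (simp add: z lookup_to_mpoly)
    ultimately show "\<exists>z. Defs.coeff a z > 0 \<and> (\<forall>w>z. Defs.coeff a w = 0)" by blast
  next
    assume "\<exists>z. Defs.coeff a z > 0 \<and> (\<forall>w>z. Defs.coeff a w = 0)"
    then obtain z where z: "Defs.coeff a z > 0" "\<And>w. w > z \<Longrightarrow> Defs.coeff a w = 0" by blast
    have "lookup (to_mpoly a) n = 0" if "n > monomial z" for n
    proof -
      obtain w where w: "n = monomial w" using monomial_surj by blast
      then have "w > z" using that by (simp add: monomial_less_iff)
      then show ?thesis using z(2) by (simp add: w lookup_to_mpoly)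
    qed
    then show "positive (to_mpoly a)"
      unfolding positive_def using z(1) by (intro exI[of _ "monomial z"]) (simp add: lookup_to_mpoly)
  qed
  also have "\<dots> \<longleftrightarrow> lex_less (cnf_coeff (fst a)) (cnf_coeff (snd a))"
  proof -
    have "Defs.coeff a z > 0 \<longleftrightarrow> cnf_coeff (fst a) z < cnf_coeff (snd a) z"
      "Defs.coeff a z = 0 \<longleftrightarrow> cnf_coeff (fst a) z = cnf_coeff (snd a) z" for z
      by (auto simp: Defs.coeff_def)
    then show ?thesis by (simp only: lex_less_def)
  qed
  finally show ?thesis by (simp only: ordinal_less_iff[of "fst a" "snd a"])
qed

lemma surints_diagonal: "a \<in> surints \<Longrightarrow> fst a = snd a \<Longrightarrow> a = zzero"
  using to_mpoly_eq_0[of a] mpoly_eqI[of "to_mpoly a" 0] by (simp add: lookup_to_mpoly Defs.coeff_def)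

text \<open>\<open>qle\<close> and \<open>qinv\<close> consult the surinteger order only against
  zero, where its case distinction collapses to comparing the two coordinates.\<close>

lemma zero_zle_iff: "zzero \<le>\<^sub>Z a \<longleftrightarrow> a \<in> surints \<and> (to_mpoly a = 0 \<or> positive (to_mpoly a))"
proof -
  have "zzero \<le>\<^sub>Z a \<longleftrightarrow> a \<in> surints \<and> fst a \<le> snd a"
    using zero_le_ordinal[of "snd a"] zero_le_ordinal[of "fst a"] zzero_in
    by (auto simp: zle_def surints_pos_def surints_neg_def zzero_def le_less)
  also have "\<dots> \<longleftrightarrow> a \<in> surints \<and> (to_mpoly a = 0 \<or> positive (to_mpoly a))"
    using surints_diagonal[of a] to_mpoly_eq_0[of a] positive_to_mpoly[of a]
    by (auto simp: le_less zzero_def)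
  finally show ?thesis .
qed

lemma zero_zless_iff: "a \<in> surints \<Longrightarrow> zzero <\<^sub>Z a \<longleftrightarrow> positive (to_mpoly a)"
  using zero_zle_iff[of a] to_mpoly_eq_0[of a] not_positive_0 by (auto simp: zless_def)

lemma zless_zero_iff:
  assumes "a \<in> surints"
  shows "a <\<^sub>Z zzero \<longleftrightarrow> positive (- to_mpoly a)"
proof -
  have "a <\<^sub>Z zzero \<longleftrightarrow> snd a < fst a"
    using zero_le_ordinal[of "snd a"] zero_le_ordinal[of "fst a"] zzero_in assms surints_diagonal[of a]
    by (auto simp: zless_def zle_def surints_pos_def surints_neg_def zzero_def)
  also have "\<dots> \<longleftrightarrow> positive (- to_mpoly a)"
    using positive_to_mpoly[of "-\<^sub>Z a"] by (simp only: to_mpoly_simps) (simp add: zneg_def)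
  finally show ?thesis .
qed

lemma denoms_iff: "a \<in> denoms \<longleftrightarrow> a \<in> surints \<and> positive (to_mpoly a)"
  using positive_to_mpoly[of a] surints_diagonal[of a]
  by (auto simp: denoms_def surints_pos_def zzero_def le_less)

lemma zdvd_iff:
  assumes "d \<in> surints" "a \<in> surints"
  shows "d dvd\<^sub>Z a \<longleftrightarrow> to_mpoly d dvd to_mpoly a"
proof
  assume "d dvd\<^sub>Z a"
  then show "to_mpoly d dvd to_mpoly a" by (auto simp: zdvd_def to_mpoly_simps)
next
  assume "to_mpoly d dvd to_mpoly a"
  then obtain c where "to_mpoly a = to_mpoly d * c" by blast
  then have "a = d *\<^sub>Z from_mpoly c"
    using from_to_mpoly[OF assms(2)] by (simp add: zmul_eq to_from_mpoly)
  then show "d dvd\<^sub>Z a" using from_mpoly_props(1) unfolding zdvd_def by blast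
qed

text \<open>Demanding 1 or -1 of a common divisor is the same as demanding a unit, by
  \<open>int_mpoly_units\<close>.\<close>

lemma zcoprime_iff:
  assumes "a \<in> surints" "b \<in> surints"
  shows "zcoprime a b \<longleftrightarrow> (\<forall>d. d dvd to_mpoly a \<longrightarrow> d dvd to_mpoly b \<longrightarrow> d dvd 1)"
proof
  assume *: "zcoprime a b"
  show "\<forall>d. d dvd to_mpoly a \<longrightarrow> d dvd to_mpoly b \<longrightarrow> d dvd 1"
  proof (intro allI impI)
    fix d assume "d dvd to_mpoly a" "d dvd to_mpoly b"
    then have "from_mpoly d = zone \<or> from_mpoly d = -\<^sub>Z zone"
      using * assms unfolding zcoprime_def by (simp add: zdvd_iff from_mpoly_props to_from_mpoly)
    then have "d = 1 \<or> d = - 1"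
      using to_from_mpoly[of d] by (auto simp: to_mpoly_simps to_mpoly_zone)
    then show "d dvd 1" by auto
  qed
next
  assume *: "\<forall>d. d dvd to_mpoly a \<longrightarrow> d dvd to_mpoly b \<longrightarrow> d dvd 1"
  show "zcoprime a b" unfolding zcoprime_def
  proof (intro ballI impI)
    fix d assume d: "d \<in> surints" "d dvd\<^sub>Z a \<and> d dvd\<^sub>Z b"
    then have "to_mpoly d = to_mpoly zone \<or> to_mpoly d = to_mpoly (-\<^sub>Z zone)"
      using * assms int_mpoly_units[of "to_mpoly d"] by (simp add: zdvd_iff to_mpoly_simps to_mpoly_zone)
    then show "d = zone \<or> d = -\<^sub>Z zone"
      using d(1) by (simp add: to_mpoly_inject zone_in zneg_closed)
  qed
qed

section \<open>Lowest terms\<close>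

lemma surrats_iff:
  "(x, y) \<in> surrats \<longleftrightarrow> x \<in> surints \<and> y \<in> surints \<and> positive (to_mpoly y) \<and>
    (\<forall>d. d dvd to_mpoly x \<longrightarrow> d dvd to_mpoly y \<longrightarrow> d dvd 1)"
  by (auto simp: surrats_def denoms_iff zcoprime_iff)

text \<open>Multiplying crosswise and cancelling u v gives one direction; conversely the opposite
  denominators serve as multipliers u = y' and v = y.\<close>

lemma fraction_equiv_iff:
  assumes "x \<in> surints" "y \<in> denoms" "x' \<in> surints" "y' \<in> denoms"
  shows "fraction_equiv (x, y) (x', y') \<longleftrightarrow> to_mpoly x * to_mpoly y' = to_mpoly x' * to_mpoly y"
proof
  assume "fraction_equiv (x, y) (x', y')"
  then obtain u v where uv: "u \<in> surints" "v \<in> surints" "u \<noteq> zzero" "v \<noteq> zzero"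
    "u *\<^sub>Z x = v *\<^sub>Z x'" "u *\<^sub>Z y = v *\<^sub>Z y'"
    unfolding fraction_equiv_def by auto
  let ?u = "to_mpoly u" and ?v = "to_mpoly v"
  have eq: "?u * to_mpoly x = ?v * to_mpoly x'" "?u * to_mpoly y = ?v * to_mpoly y'"
    using uv(5,6) to_mpoly_simps(2) by metis+
  have "(?u * ?v) * (to_mpoly x * to_mpoly y') = (?u * to_mpoly x) * (?v * to_mpoly y')"
    by (simp add: mult_ac)
  also have "\<dots> = (?u * ?v) * (to_mpoly x' * to_mpoly y)"
    unfolding eq(1) eq(2)[symmetric] by (simp add: mult_ac)
  finally show "to_mpoly x * to_mpoly y' = to_mpoly x' * to_mpoly y"
    using uv by (simp add: to_mpoly_eq_0)
next
  assume *: "to_mpoly x * to_mpoly y' = to_mpoly x' * to_mpoly y"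
  have eq: "y' *\<^sub>Z x = y *\<^sub>Z x'" "y' *\<^sub>Z y = y *\<^sub>Z y'"
    using * by (simp_all add: zmul_eq mult.commute)
  show "fraction_equiv (x, y) (x', y')"
    unfolding fraction_equiv_def
    by (rule bexI[of _ y'], rule bexI[of _ y]) (use assms eq in \<open>auto simp: denoms_def surints_pos_def\<close>)
qed

lemma positive_nonzero: "positive f \<Longrightarrow> f \<noteq> 0"
  using not_positive_0 by auto

text \<open>By Euclid's lemma the denominators divide each other, so they differ by a unit, and
  positivity rules out -1.\<close>

lemma reduced_fraction_unique:
  assumes "(x, y) \<in> surrats" "(x', y') \<in> surrats" "to_mpoly x * to_mpoly y' = to_mpoly x' * to_mpoly y"
  shows "(x, y) = (x', y')"
proof -
  let ?y = "to_mpoly y" and ?y' = "to_mpoly y'"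
  have p: "positive ?y" "positive ?y'" using assms by (auto simp: surrats_iff)
  then have nz: "?y \<noteq> 0" "?y' \<noteq> 0" by (auto simp: positive_nonzero)
  have "?y dvd ?y'"
    by (rule int_mpoly_coprime_dvd_mult[of "to_mpoly x"])
      (use assms nz in \<open>auto simp: surrats_iff\<close>)
  then obtain u where u: "?y' = ?y * u" by blast
  have "?y' dvd ?y"
    by (rule int_mpoly_coprime_dvd_mult[of "to_mpoly x'"])
      (use assms nz in \<open>auto simp: surrats_iff simp flip: assms(3)\<close>)
  then have "u dvd 1" using u nz dvd_mult_cancel_left[of ?y u 1] by simp
  then have "u = 1 \<or> u = - 1" by (rule int_mpoly_units)
  then have "?y = ?y'" using u p positive_minus[of ?y] by auto
  moreover from this have "to_mpoly x = to_mpoly x'" using assms(3) nz by simp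
  ultimately show ?thesis using assms by (simp add: surrats_iff to_mpoly_inject)
qed

text \<open>A reduced denominator may have the wrong sign; negating numerator and denominator
  together repairs it and preserves coprimality.\<close>

lemma reduced_fraction_exists:
  assumes "y \<in> denoms"
  shows "\<exists>x' y'. (x', y') \<in> surrats \<and> to_mpoly x * to_mpoly y' = to_mpoly x' * to_mpoly y"
proof -
  have nz: "to_mpoly y \<noteq> 0" using assms by (simp add: denoms_iff positive_nonzero)
  obtain a b where ab: "to_mpoly x * b = a * to_mpoly y" "b \<noteq> 0"
    "\<forall>d. d dvd a \<and> d dvd b \<longrightarrow> d dvd 1"
    using int_mpoly_reduced_exists[OF nz, of "to_mpoly x"] by metis
  consider "positive b" | "positive (- b)" using positive_total[of b] ab by auto
  then show ?thesis
  proof cases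
    case 1
    then show ?thesis using ab
      by (intro exI[of _ "from_mpoly a"] exI[of _ "from_mpoly b"])
        (auto simp: surrats_iff from_mpoly_props to_from_mpoly)
  next
    case 2
    then show ?thesis using ab
      by (intro exI[of _ "from_mpoly (- a)"] exI[of _ "from_mpoly (- b)"])
        (auto simp: surrats_iff from_mpoly_props to_from_mpoly)
  qed
qed

section \<open>Surrationals inside the fraction field\<close>

definition to_fract :: "'v::set_universe surrat \<Rightarrow> 'v int_mpoly_dual fract" where
  "to_fract p = Fract (to_mpoly (fst p)) (to_mpoly (snd p))"

text \<open>Injectivity is the uniqueness of lowest terms. It lets every equation between
  surrationals be checked in the fraction field.\<close>

lemma to_fract_inject:
  assumes "p \<in> surrats" "q \<in> surrats"
  shows "to_fract p = to_fract q \<longleftrightarrow> p = q"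
  using assms reduced_fraction_unique[of "fst p" "snd p" "fst q" "snd q"]
  by (cases p, cases q) (auto simp: to_fract_def surrats_iff positive_nonzero eq_fract)

text \<open>The description in \<open>reduce\<close> has exactly one solution: two reduced pairs
  equivalent to (x, y) agree crosswise after cancelling the common factor y.\<close>

lemma reduce_props:
  assumes "x \<in> surints" "y \<in> denoms"
  shows "reduce (x, y) \<in> surrats" "to_fract (reduce (x, y)) = Fract (to_mpoly x) (to_mpoly y)"
proof -
  obtain x' y' where q: "(x', y') \<in> surrats" "to_mpoly x * to_mpoly y' = to_mpoly x' * to_mpoly y"
    using reduced_fraction_exists assms by blast
  have q': "x' \<in> surints" "y' \<in> denoms" using q by (auto simp: surrats_def)
  have "fraction_equiv (x, y) (x', y')" using fraction_equiv_iff assms q q' by blast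
  moreover have "r = (x', y')" if r: "r \<in> surrats" "fraction_equiv (x, y) r" for r
  proof -
    obtain a b where ab: "r = (a, b)" by (cases r)
    then have "a \<in> surints" "b \<in> denoms" using r by (auto simp: surrats_def)
    then have e: "to_mpoly x * to_mpoly b = to_mpoly a * to_mpoly y"
      using fraction_equiv_iff assms r ab by blast
    have nz: "to_mpoly y \<noteq> 0" using assms by (simp add: denoms_iff positive_nonzero)
    have "to_mpoly y * (to_mpoly a * to_mpoly y') = (to_mpoly a * to_mpoly y) * to_mpoly y'"
      by (simp add: mult_ac)
    also have "\<dots> = to_mpoly b * (to_mpoly x * to_mpoly y')"
      unfolding e[symmetric] by (simp add: mult_ac)
    also have "\<dots> = to_mpoly y * (to_mpoly x' * to_mpoly b)"
      unfolding q(2) by (simp add: mult_ac)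
    finally show ?thesis using reduced_fraction_unique[OF _ q(1), of a b] nz r ab by simp
  qed
  ultimately have "reduce (x, y) = (x', y')" unfolding reduce_def using q(1) by blast
  then show "reduce (x, y) \<in> surrats" "to_fract (reduce (x, y)) = Fract (to_mpoly x) (to_mpoly y)"
    using q q' assms by (auto simp: to_fract_def eq_fract denoms_iff positive_nonzero)
qed

lemma surratsD:
  assumes "p \<in> surrats"
  shows "fst p \<in> surints" "snd p \<in> surints" "snd p \<in> denoms" "positive (to_mpoly (snd p))" "to_mpoly (snd p) \<noteq> 0"
  using assms by (auto simp: surrats_def denoms_iff positive_nonzero)

lemma denoms_mult: "a \<in> denoms \<Longrightarrow> b \<in> denoms \<Longrightarrow> a *\<^sub>Z b \<in> denoms"
  by (simp add: denoms_iff surint_ops_closed to_mpoly_simps positive_mult)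

lemma qadd_props:
  assumes "p \<in> surrats" "q \<in> surrats"
  shows "p +\<^sub>Q q \<in> surrats" "to_fract (p +\<^sub>Q q) = to_fract p + to_fract q"
  using reduce_props[of "fst p *\<^sub>Z snd q +\<^sub>Z snd p *\<^sub>Z fst q" "snd p *\<^sub>Z snd q"]
    surratsD[OF assms(1)] surratsD[OF assms(2)]
  by (simp_all add: qadd_def surint_ops_closed denoms_mult to_fract_def to_mpoly_simps mult.commute)

lemma qmul_props:
  assumes "p \<in> surrats" "q \<in> surrats"
  shows "p *\<^sub>Q q \<in> surrats" "to_fract (p *\<^sub>Q q) = to_fract p * to_fract q"
  using reduce_props[of "fst p *\<^sub>Z fst q" "snd p *\<^sub>Z snd q"] surratsD[OF assms(1)] surratsD[OF assms(2)]
  by (simp_all add: qmul_def surint_ops_closed denoms_mult to_fract_def to_mpoly_simps)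

lemma qneg_props:
  assumes "p \<in> surrats"
  shows "-\<^sub>Q p \<in> surrats" "to_fract (-\<^sub>Q p) = - to_fract p"
  using assms by (cases p; auto simp: qneg_def surrats_iff zneg_closed to_mpoly_simps to_fract_def)+

lemma qzero_props: "qzero \<in> surrats" "to_fract qzero = 0"
  by (auto simp: qzero_def surrats_iff zzero_in zone_in to_mpoly_zone to_mpoly_zzero positive_1
      to_fract_def fract_collapse)

lemma qone_props: "qone \<in> surrats" "to_fract qone = 1"
  by (auto simp: qone_def surrats_iff zone_in to_mpoly_zone positive_1 to_fract_def One_fract_def)

text \<open>Coprimality is symmetric, so exchanging the coordinates keeps lowest terms; for negative
  p both signs are flipped to keep the denominator positive. The value at zero agrees with the
  convention that \<open>inverse\<close> maps 0 to 0.\<close>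

lemma qinv_props:
  assumes "p \<in> surrats"
  shows "qinv p \<in> surrats" "to_fract (qinv p) = inverse (to_fract p)"
proof -
  obtain a b where p: "p = (a, b)" by (cases p)
  have ab: "a \<in> surints" "b \<in> surints" "positive (to_mpoly b)"
    "\<And>d. d dvd to_mpoly a \<Longrightarrow> d dvd to_mpoly b \<Longrightarrow> d dvd 1"
    using assms p by (auto simp: surrats_iff)
  consider "to_mpoly a = 0" | "positive (to_mpoly a)" | "positive (- to_mpoly a)" "\<not> positive (to_mpoly a)"
    using positive_total positive_minus by blast
  then have "qinv p \<in> surrats \<and> to_fract (qinv p) = inverse (to_fract p)"
  proof cases
    case 1
    then have "qinv p = qzero"
      using ab by (simp add: qinv_def p zero_zless_iff zless_zero_iff qzero_def not_positive_0)
    then show ?thesis using 1 qzero_props by (simp add: p to_fract_def fract_collapse)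
  next
    case 2
    then have "qinv p = (b, a)" using ab by (simp add: qinv_def p zero_zless_iff)
    then show ?thesis using 2 ab by (simp add: surrats_iff p to_fract_def)
  next
    case 3
    then have "qinv p = (-\<^sub>Z b, -\<^sub>Z a)" using ab by (simp add: qinv_def p zero_zless_iff zless_zero_iff)
    then show ?thesis using 3 ab by (simp add: surrats_iff p to_fract_def zneg_closed to_mpoly_simps)
  qed
  then show "qinv p \<in> surrats" "to_fract (qinv p) = inverse (to_fract p)" by blast+
qed

section \<open>The order on fractions\<close>

definition fract_positive :: "'v::set_universe int_mpoly_dual fract \<Rightarrow> bool" where
  "fract_positive q \<longleftrightarrow> (\<exists>a b. positive a \<and> positive b \<and> q = Fract a b)"

lemma fract_positive_add: "fract_positive p \<Longrightarrow> fract_positive q \<Longrightarrow> fract_positive (p + q)"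
  unfolding fract_positive_def by (metis add_fract positive_add positive_mult positive_nonzero)

lemma fract_positive_mult: "fract_positive p \<Longrightarrow> fract_positive q \<Longrightarrow> fract_positive (p * q)"
  unfolding fract_positive_def by (metis mult_fract positive_mult)

lemma not_fract_positive_0: "\<not> fract_positive 0"
  unfolding fract_positive_def Zero_fract_def by (auto simp: eq_fract positive_nonzero)

text \<open>The sign does not depend on the representation: multiplying crosswise with positive
  denominators preserves the sign of the numerator.\<close>

lemma fract_positive_Fract:
  assumes "positive b"
  shows "fract_positive (Fract a b) \<longleftrightarrow> positive a"
proof
  assume "fract_positive (Fract a b)"
  then obtain c d where cd: "positive c" "positive d" "Fract a b = Fract c d"
    unfolding fract_positive_def by blast
  then have "a * d = c * b" using assms by (simp add: eq_fract positive_nonzero)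
  then have ad: "positive (a * d)" using cd assms by (simp add: positive_mult)
  have "a \<noteq> 0" using ad not_positive_0 by auto
  moreover have "\<not> positive (- a)" using ad cd(2) positive_mult[of "- a" d] positive_minus[of "a * d"] by auto
  ultimately show "positive a" using positive_total by blast
qed (use assms in \<open>auto simp: fract_positive_def\<close>)

lemma fract_positive_total: "q = 0 \<or> fract_positive q \<or> fract_positive (- q)"
proof (cases q)
  case (Fract a b)
  \<comment> \<open>A negative denominator becomes positive when both parts are negated.\<close>
  obtain c d where cd: "q = Fract c d" "positive d"
    using Fract positive_total[of b] by (metis minus_fract_cancel)
  then show ?thesis
    using positive_total[of c] by (auto simp: fract_positive_Fract fract_collapse)
qed

text \<open>The difference is in lowest terms with positive denominator, so the sign of its first
  coordinate is the sign of the fraction.\<close>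

lemma qle_iff:
  assumes "p \<in> surrats" "q \<in> surrats"
  shows "p \<preceq>\<^sub>Q q \<longleftrightarrow> to_fract q - to_fract p = 0 \<or> fract_positive (to_fract q - to_fract p)"
proof -
  define r where "r = q +\<^sub>Q -\<^sub>Q p"
  have r: "r \<in> surrats" "to_fract r = to_fract q - to_fract p"
    using assms by (simp_all add: r_def qadd_props qneg_props)
  have "to_mpoly (fst r) = 0 \<longleftrightarrow> to_fract r = 0"
    using surratsD[OF r(1)] by (simp add: to_fract_def Zero_fract_def eq_fract)
  moreover have "positive (to_mpoly (fst r)) \<longleftrightarrow> fract_positive (to_fract r)"
    using surratsD[OF r(1)] by (simp add: to_fract_def fract_positive_Fract)
  ultimately show ?thesis
    using surratsD(1)[OF r(1)] by (simp add: qle_def zero_zle_iff flip: r_def r(2))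
qed

lemma qless_iff:
  assumes "p \<in> surrats" "q \<in> surrats"
  shows "p \<prec>\<^sub>Q q \<longleftrightarrow> fract_positive (to_fract q - to_fract p)"
  using qle_iff[OF assms] to_fract_inject[OF assms] not_fract_positive_0 by (auto simp: qless_def)

lemma linear_order_surrats:
  "linear_order_on surrats {(p, q). p \<in> surrats \<and> q \<in> surrats \<and> p \<preceq>\<^sub>Q q}"
proof -
  have "p \<preceq>\<^sub>Q r" if "p \<preceq>\<^sub>Q q" "q \<preceq>\<^sub>Q r" "p \<in> surrats" "q \<in> surrats" "r \<in> surrats" for p q r :: "'a surrat"
    using that fract_positive_add[of "to_fract q - to_fract p" "to_fract r - to_fract q"]
    by (auto simp: qle_iff)
  moreover have "p = q" if "p \<preceq>\<^sub>Q q" "q \<preceq>\<^sub>Q p" "p \<in> surrats" "q \<in> surrats" for p q :: "'a surrat"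
    using that fract_positive_add[of "to_fract q - to_fract p" "to_fract p - to_fract q"]
      not_fract_positive_0 to_fract_inject[of p q]
    by (auto simp: qle_iff)
  moreover have "p \<preceq>\<^sub>Q q \<or> q \<preceq>\<^sub>Q p" if "p \<in> surrats" "q \<in> surrats" for p q :: "'a surrat"
    using that fract_positive_total[of "to_fract q - to_fract p"] by (auto simp: qle_iff)
  moreover have "p \<preceq>\<^sub>Q p" if "p \<in> surrats" for p :: "'a surrat"
    using that by (simp add: qle_iff)
  ultimately show ?thesis
    unfolding linear_order_on_def partial_order_on_def preorder_on_def
      refl_on_def total_on_def trans_def antisym_def by blast
qed

text \<open>The Burali-Forti argument: the ordinals embed as fractions with denominator one, so
  smallness would yield, by separation and replacement, a set of all ordinals, and an ordinal above
  all of them would be a member of itself.\<close>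

lemma not_small_surrats: "\<not> small TYPE('v::set_universe) (surrats :: 'v surrat set)"
proof
  assume "small TYPE('v) (surrats :: 'v surrat set)"
  then obtain f :: "'v surrat \<Rightarrow> 'v" and v where f: "inj_on f surrats" "f ` surrats = elts v"
    unfolding small_def by blast
  define h :: "'v ordinal \<Rightarrow> 'v surrat" where "h a = ((0, a), zone)" for a
  have "(0, a) \<in> surints" for a :: "'v ordinal"
    by (simp add: surints_def cnf_exponents_eq cnf_coeff_0)
  then have h: "h a \<in> surrats" for a
    by (simp add: h_def surrats_iff zone_in to_mpoly_zone positive_1)
  have inj: "inj (f \<circ> h)"
  proof (rule injI)
    fix a b assume "(f \<circ> h) a = (f \<circ> h) b"
    then have "h a = h b" using inj_onD[OF f(1) _ h h] by simp
    then show "a = b" by (simp add: h_def)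
  qed
  have "range (f \<circ> h) \<subseteq> elts v" using f(2) h by auto
  then obtain w where w: "elts w = range (f \<circ> h)" using separation by blast
  obtain u where u: "elts u = (\<lambda>x. Rep_ordinal (inv (f \<circ> h) x)) ` elts w" using replacement by blast
  have "elts u = range (Rep_ordinal :: 'v ordinal \<Rightarrow> 'v)"
    using inv_f_f[OF inj] by (auto simp: u w image_image)
  then have all: "Rep_ordinal a \<in> elts u" for a :: "'v ordinal" by simp
  have "\<forall>x\<in>elts u. is_ordinal x" using u Rep_ordinal by auto
  then obtain t where t: "is_ordinal t" "\<forall>x\<in>elts u. x \<in> elts t" using ordinal_above by blast
  then have "t \<in> elts t" using all[of "Abs_ordinal t"] by (simp add: Abs_ordinal_inverse)
  then show False using wf_not_refl[OF foundation] by auto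
qed

theorem theorem4:
  fixes Q :: "'v::set_universe surrat set"
  defines "Q \<equiv> surrats"
  shows "\<not> small TYPE('v) Q \<and>
    linear_order_on Q {(p, q). p \<in> Q \<and> q \<in> Q \<and> p \<preceq>\<^sub>Q q} \<and>
    qzero \<in> Q \<and> qone \<in> Q \<and>
    (\<forall>p\<in>Q. \<forall>q\<in>Q. p +\<^sub>Q q \<in> Q) \<and>
    (\<forall>p\<in>Q. \<forall>q\<in>Q. p *\<^sub>Q q \<in> Q) \<and>
    (\<forall>p\<in>Q. -\<^sub>Q p \<in> Q) \<and>
    (\<forall>p\<in>Q. qinv p \<in> Q) \<and>
    (\<forall>p\<in>Q. \<forall>q\<in>Q. \<forall>r\<in>Q. (p +\<^sub>Q q) +\<^sub>Q r = p +\<^sub>Q (q +\<^sub>Q r)) \<and>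
    (\<forall>p\<in>Q. \<forall>q\<in>Q. p +\<^sub>Q q = q +\<^sub>Q p) \<and>
    (\<forall>p\<in>Q. p +\<^sub>Q qzero = p) \<and>
    (\<forall>p\<in>Q. p +\<^sub>Q -\<^sub>Q p = qzero) \<and>
    (\<forall>p\<in>Q. \<forall>q\<in>Q. \<forall>r\<in>Q. (p *\<^sub>Q q) *\<^sub>Q r = p *\<^sub>Q (q *\<^sub>Q r)) \<and>
    (\<forall>p\<in>Q. \<forall>q\<in>Q. p *\<^sub>Q q = q *\<^sub>Q p) \<and>
    (\<forall>p\<in>Q. p *\<^sub>Q qone = p) \<and>
    (\<forall>p\<in>Q. \<forall>q\<in>Q. \<forall>r\<in>Q. p *\<^sub>Q (q +\<^sub>Q r) = p *\<^sub>Q q +\<^sub>Q p *\<^sub>Q r) \<and>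
    (\<forall>p\<in>Q. \<forall>q\<in>Q. \<forall>r\<in>Q. \<forall>s\<in>Q. p \<prec>\<^sub>Q q \<and> r \<prec>\<^sub>Q s \<longrightarrow> p +\<^sub>Q r \<prec>\<^sub>Q q +\<^sub>Q s) \<and>
    (\<forall>p\<in>Q. \<forall>q\<in>Q. qzero \<prec>\<^sub>Q p \<and> qzero \<prec>\<^sub>Q q \<longrightarrow> qzero \<prec>\<^sub>Q p *\<^sub>Q q) \<and>
    (\<forall>p\<in>Q. p \<noteq> qzero \<longrightarrow> (\<exists>q\<in>Q. p *\<^sub>Q q = qone))"
proof -
  note props = qadd_props qmul_props qneg_props qinv_props qzero_props qone_props
  have add_mono: "p +\<^sub>Q r \<prec>\<^sub>Q q +\<^sub>Q s"
    if "p \<in> Q" "q \<in> Q" "r \<in> Q" "s \<in> Q" "p \<prec>\<^sub>Q q" "r \<prec>\<^sub>Q s" for p q r s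
    using that fract_positive_add[of "to_fract q - to_fract p" "to_fract s - to_fract r"]
    by (simp add: Q_def qless_iff props algebra_simps)
  have mult_pos: "qzero \<prec>\<^sub>Q p *\<^sub>Q q" if "p \<in> Q" "q \<in> Q" "qzero \<prec>\<^sub>Q p" "qzero \<prec>\<^sub>Q q" for p q
    using that fract_positive_mult by (simp add: Q_def qless_iff props)
  have inverse: "\<exists>q\<in>Q. p *\<^sub>Q q = qone" if "p \<in> Q" "p \<noteq> qzero" for p
  proof
    have "to_fract p \<noteq> 0" using that to_fract_inject[of p qzero] by (simp add: Q_def props)
    then show "p *\<^sub>Q qinv p = qone"
      using that to_fract_inject[of "p *\<^sub>Q qinv p" qone] by (simp add: Q_def props)
    show "qinv p \<in> Q" using that by (simp add: Q_def props)
  qed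
  \<comment> \<open>With this, each equational law on \<open>Q\<close> becomes an identity in the
    fraction field.\<close>
  have eq: "p = q \<longleftrightarrow> to_fract p = to_fract q" if "p \<in> Q" "q \<in> Q" for p q
    using that to_fract_inject[of p q] by (simp add: Q_def)
  have closed: "p +\<^sub>Q q \<in> Q" "p *\<^sub>Q q \<in> Q" "-\<^sub>Q p \<in> Q" "qinv p \<in> Q"
    if "p \<in> Q" "q \<in> Q" for p q
    using that by (simp_all add: Q_def props)
  have base: "qzero \<in> Q" "qone \<in> Q" "\<not> small TYPE('v) Q"
    "linear_order_on Q {(p, q). p \<in> Q \<and> q \<in> Q \<and> p \<preceq>\<^sub>Q q}"
    unfolding Q_def by (fact props not_small_surrats linear_order_surrats)+
  have assoc_add: "(p +\<^sub>Q q) +\<^sub>Q r = p +\<^sub>Q (q +\<^sub>Q r)" and assoc_mult: "(p *\<^sub>Q q) *\<^sub>Q r = p *\<^sub>Q (q *\<^sub>Q r)"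
    and distrib: "p *\<^sub>Q (q +\<^sub>Q r) = p *\<^sub>Q q +\<^sub>Q p *\<^sub>Q r"
    if "p \<in> Q" "q \<in> Q" "r \<in> Q" for p q r
    using that by (subst eq; simp add: Q_def props algebra_simps)+
  have comm: "p +\<^sub>Q q = q +\<^sub>Q p" "p *\<^sub>Q q = q *\<^sub>Q p" if "p \<in> Q" "q \<in> Q" for p q
    using that by (subst eq; simp add: Q_def props algebra_simps)+
  have neutral: "p +\<^sub>Q qzero = p" "p *\<^sub>Q qone = p" "p +\<^sub>Q -\<^sub>Q p = qzero" if "p \<in> Q" for p
    using that by (subst eq; simp add: Q_def props)+
  show ?thesis
    by (intro conjI ballI impI; (elim conjE)?;
        (rule base closed assoc_add assoc_mult distrib comm neutral add_mono mult_pos inverse; assumption))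
qed

end
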